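(* Let $\Omega\subset\mathbb{R}^2$ be an open bounded domain with Lipschitz continuous boundary, let $\mathcal{T}_h$ be a shape-regular, quasi-uniform mesh of $\Omega$ consisting of rectangles, and let $j\ge 0$ be an integer. Let the weak discrete space $S_h$ and the local gradient spaces $V(K)$, $K\in\mathcal{T}_h$, be given by either one of the following two types of rectangular elements: (1) $(Q_j(K_0),\,Q_j(F),\,RT_j(K))$: $v_0|_{K_0}\in Q_j(K_0)$, $v_b|_F\in Q_j(F)$, and $V(K)=RT_j(K)$; (2) $(P_j(K_0),\,P_{j+1}(F),\,BDM_{j+1}(K))$: $v_0|_{K_0}\in P_j(K_0)$, $v_b|_F\in P_{j+1}(F)$, and $V(K)=BDM_{j+1}(K)$. Let $\nabla_d$ denote the discrete gradient on $S_h$ defined with these local spaces $V(K)$. Then for every $v_h=\{v_0,v_b\}\in S_h$ and every $K\in\mathcal{T}_h$: $\nabla_d v_h|_K=0$ if and only if $v_0=v_b=\text{constant}$ on $K$, i.e. there is a constant $c\in\mathbb{R}$ such that $v_0=c$ on $K_0$ and $v_b=c$ on every edge $F\subset\partial K$.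
   Context: Rectangles have sides parallel to the coordinate axes. For a rectangle $K\in\mathcal{T}_h$, $K_0$ denotes its interior and $\partial K$ its boundary, which consists of four edges; $\mathcal{F}_h$ is the set of all edges of $\mathcal{T}_h$. The unit outward normal on $\partial K$ is $\mathbf{n}$. Polynomial spaces: $P_k(K)$ is the space of polynomials in $(x,y)$ of total degree $\le k$; $Q_{i,k}(K)$ is the space of polynomials of degree $\le i$ in $x$ and $\le k$ in $y$; $Q_k(K)=Q_{k,k}(K)$. On an edge $F$, $P_k(F)=Q_k(F)$ is the space of univariate polynomials of degree $\le k$ on $F$. With $\mathbf{curl}=(-\partial/\partial y,\ \partial/\partial x)^t$, $$RT_j(K)=Q_{j+1,j}(K)\times Q_{j,j+1}(K),$$ $$BDM_{j+1}(K)=[P_{j+1}(K)]^2+\mathrm{span}\{\mathbf{curl}(x^{j+2}y),\ \mathbf{curl}(xy^{j+2})\}.$$ Weak discrete space: $S_h$ is the set of pairs $v_h=\{v_0,v_b\}$, where $v_0$ assigns to each $K\in\mathcal{T}_h$ a function on $K_0$ and $v_b$ assigns to each $F\in\mathcal{F}_h$ a (single-valued) function on $F$, each lying in the prescribed polynomial space. No continuity is required between elements, between edges, or between $v_0$ and $v_b$. Discrete gradient: for $v_h=\{v_0,v_b\}\in S_h$, $\nabla_d v_h$ is the vector field whose restriction to each $K\in\mathcal{T}_h$ is the unique element of $V(K)$ satisfying $$\int_K \nabla_d v_h\cdot \mathbf{q}\,dx=-\int_K v_0\,\nabla\cdot\mathbf{q}\,dx+\int_{\partial K} v_b\,\mathbf{q}\cdot\mathbf{n}\,ds\qquad\text{for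 all }\mathbf{q}\in V(K).$$ *)

theory Defs
  imports "HOL-Analysis.Analysis" "HOL-Computational_Algebra.Polynomial"
begin

type_synonym point = "real \<times> real"
type_synonym vfield = "point \<Rightarrow> point"

subsection \<open>Domain and mesh\<close>

text \<open>Near each boundary point the set is the strict epigraph of a Lipschitz function in
  some orthonormal frame \<open>e1, e2\<close>; openness of \<open>U\<close> makes the boundary inside \<open>U\<close> the graph.\<close>

definition lipschitz_boundary :: "point set \<Rightarrow> bool" where
  "lipschitz_boundary \<Omega> \<longleftrightarrow>
     (\<forall>x\<in>frontier \<Omega>. \<exists>U e1 e2 (f :: real \<Rightarrow> real) L.
        open U \<and> x \<in> U \<and> norm e1 = 1 \<and> norm e2 = 1 \<and> e1 \<bullet> e2 = 0 \<and>
        L-lipschitz_on UNIV f \<and>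
        \<Omega> \<inter> U = {z \<in> U. f (z \<bullet> e1) < z \<bullet> e2})"

text \<open>Mesh elements are closed rectangles; nonempty interiors exclude degenerate ones.
  Conformity (no hanging nodes) is not required.\<close>

definition rectangular_mesh :: "point set \<Rightarrow> point set set \<Rightarrow> bool" where
  "rectangular_mesh \<Omega> \<T> \<longleftrightarrow> \<T> division_of (closure \<Omega>) \<and> (\<forall>K\<in>\<T>. interior K \<noteq> {})"

definition inscribed_diameter :: "point set \<Rightarrow> real" where
  "inscribed_diameter K = Sup {2 * r |r. 0 \<le> r \<and> (\<exists>z. cball z r \<subseteq> K)}"

definition mesh_size :: "point set set \<Rightarrow> real" where
  "mesh_size \<T> = Max (diameter ` \<T>)"

text \<open>The two mesh conditions carry their constants explicitly, so that they are meaningful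
  for a single mesh and uniform over a family of meshes sharing \<open>\<sigma>\<close> and \<open>\<tau>\<close>.\<close>

definition shape_regular :: "real \<Rightarrow> point set set \<Rightarrow> bool" where
  "shape_regular \<sigma> \<T> \<longleftrightarrow> (\<forall>K\<in>\<T>. diameter K \<le> \<sigma> * inscribed_diameter K)"

definition quasi_uniform :: "real \<Rightarrow> point set set \<Rightarrow> bool" where
  "quasi_uniform \<tau> \<T> \<longleftrightarrow> (\<forall>K\<in>\<T>. mesh_size \<T> \<le> \<tau> * diameter K)"

subsection \<open>Edges\<close>

datatype side = West | East | South | North

fun side_start :: "point set \<Rightarrow> side \<Rightarrow> point" where
  "side_start K East = (fst (interval_upperbound K), snd (interval_lowerbound K))"
| "side_start K North = (fst (interval_lowerbound K), snd (interval_upperbound K))"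
| "side_start K _ = interval_lowerbound K"

fun side_end :: "point set \<Rightarrow> side \<Rightarrow> point" where
  "side_end K West = (fst (interval_lowerbound K), snd (interval_upperbound K))"
| "side_end K South = (fst (interval_upperbound K), snd (interval_lowerbound K))"
| "side_end K _ = interval_upperbound K"

fun outward_normal :: "side \<Rightarrow> point" where
  "outward_normal West = (-1, 0)"
| "outward_normal East = (1, 0)"
| "outward_normal South = (0, -1)"
| "outward_normal North = (0, 1)"

definition edge :: "point set \<Rightarrow> side \<Rightarrow> point set" where
  "edge K s = closed_segment (side_start K s) (side_end K s)"

definition edges :: "point set \<Rightarrow> point set set" where
  "edges K = edge K ` {West, East, South, North}"

definition mesh_edges :: "point set set \<Rightarrow> point set set" where
  "mesh_edges \<T> = (\<Union>K\<in>\<T>. edges K)"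

text \<open>Arc length integral over the segment from \<open>u\<close> to \<open>w\<close>.\<close>

definition segment_integral :: "point \<Rightarrow> point \<Rightarrow> (point \<Rightarrow> real) \<Rightarrow> real" where
  "segment_integral u w f = norm (w - u) * integral {0..1} (\<lambda>t. f (linepath u w t))"

subsection \<open>Polynomial spaces\<close>

text \<open>A polynomial on a nondegenerate rectangle is identified with the polynomial function on
  the whole plane that extends it, so the spaces on \<open>K\<close> are rendered without an argument \<open>K\<close>.\<close>

definition P_space :: "nat \<Rightarrow> (point \<Rightarrow> real) set" where
  "P_space k = {f. \<exists>c. f = (\<lambda>(x, y). \<Sum>(a, b)\<in>{(a, b). a + b \<le> k}. c a b * x ^ a * y ^ b)}"

definition Q_space :: "nat \<Rightarrow> nat \<Rightarrow> (point \<Rightarrow> real) set" where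
  "Q_space i k = {f. \<exists>c. f = (\<lambda>(x, y). \<Sum>a\<le>i. \<Sum>b\<le>k. c a b * x ^ a * y ^ b)}"

text \<open>Polynomials of degree at most \<open>k\<close> on a segment, in an affine parameter along it.\<close>

definition P_edge :: "nat \<Rightarrow> point set \<Rightarrow> (point \<Rightarrow> real) set" where
  "P_edge k F = {g. \<exists>u w p. F = closed_segment u w \<and> degree p \<le> k \<and>
                        (\<forall>t\<in>{0..1}. g (linepath u w t) = poly p t)}"

definition partial_x :: "(point \<Rightarrow> real) \<Rightarrow> point \<Rightarrow> real" where
  "partial_x f z = deriv (\<lambda>x. f (x, snd z)) (fst z)"

definition partial_y :: "(point \<Rightarrow> real) \<Rightarrow> point \<Rightarrow> real" where
  "partial_y f z = deriv (\<lambda>y. f (fst z, y)) (snd z)"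

definition divergence :: "vfield \<Rightarrow> point \<Rightarrow> real" where
  "divergence q z = partial_x (\<lambda>w. fst (q w)) z + partial_y (\<lambda>w. snd (q w)) z"

definition curl :: "(point \<Rightarrow> real) \<Rightarrow> vfield" where
  "curl f z = (- partial_y f z, partial_x f z)"

definition RT :: "nat \<Rightarrow> vfield set" where
  "RT j = {q. (\<lambda>z. fst (q z)) \<in> Q_space (j + 1) j \<and> (\<lambda>z. snd (q z)) \<in> Q_space j (j + 1)}"

definition BDM :: "nat \<Rightarrow> vfield set" where
  "BDM m = {q. \<exists>p1\<in>P_space m. \<exists>p2\<in>P_space m. \<exists>\<alpha> \<beta>. q = (\<lambda>z. (p1 z, p2 z)
              + \<alpha> *\<^sub>R curl (\<lambda>(x, y). x ^ (m + 1) * y) z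
              + \<beta> *\<^sub>R curl (\<lambda>(x, y). x * y ^ (m + 1)) z)}"

subsection \<open>Weak functions and the discrete gradient\<close>

text \<open>A weak function \<open>(v0, vb)\<close> gives for each element \<open>K\<close> a function \<open>v0 K\<close>, of which only the
  values on the interior of \<open>K\<close> matter, and for each edge \<open>F\<close> a function \<open>vb F\<close>, of which only
  the values on \<open>F\<close> matter.\<close>

type_synonym weak_fun = "(point set \<Rightarrow> point \<Rightarrow> real) \<times> (point set \<Rightarrow> point \<Rightarrow> real)"

definition weak_space ::
  "point set set \<Rightarrow> (point \<Rightarrow> real) set \<Rightarrow> (point set \<Rightarrow> (point \<Rightarrow> real) set) \<Rightarrow> weak_fun set" where
  "weak_space \<T> P0 Pb = {(v0, vb).
      (\<forall>K\<in>\<T>. \<exists>p\<in>P0. \<forall>z\<in>interior K. v0 K z = p z) \<and>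
      (\<forall>F\<in>mesh_edges \<T>. vb F \<in> Pb F)}"

definition boundary_flux :: "(point set \<Rightarrow> point \<Rightarrow> real) \<Rightarrow> vfield \<Rightarrow> point set \<Rightarrow> real" where
  "boundary_flux vb q K = (\<Sum>s\<in>{West, East, South, North}.
      segment_integral (side_start K s) (side_end K s)
        (\<lambda>z. vb (edge K s) z * (q z \<bullet> outward_normal s)))"

text \<open>The discrete gradient is given elementwise: \<open>discrete_gradient V v K\<close> is its restriction
  to \<open>K\<close>, read as a polynomial field.\<close>

definition discrete_gradient :: "vfield set \<Rightarrow> weak_fun \<Rightarrow> point set \<Rightarrow> vfield" where
  "discrete_gradient V v K = (THE g. g \<in> V \<and>
     (\<forall>q\<in>V. integral K (\<lambda>z. g z \<bullet> q z) =
        - integral K (\<lambda>z. fst v K z * divergence q z) + boundary_flux (snd v) q K))"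

end

theory Submission
  imports Defs
begin

text \<open>On a rectangle \<open>K\<close> the interior value of a weak function is a polynomial \<open>p\<close>, and its edge
  values are univariate polynomials.  Green's formula turns the right-hand side of the equation
  defining the discrete gradient into
    \[ \int_K \nabla p \cdot q + \int_{\partial K} (v_b - p)\, q \cdot n, \]
  see \<open>load_eq_gradient_and_jumps\<close>.  For a constant weak function this is zero for all \<open>q\<close>.

  Conversely, let it vanish for all \<open>q\<close> in \<open>V\<close>.  On \<open>K = [l1, u1] \<times> [l2, u2]\<close> the bubble
  \<open>((x - l1) (u1 - x) p\<^sub>x, 0)\<close> lies in \<open>V\<close> and has no normal trace, so \<open>p\<^sub>x\<close> vanishes, and in the same
  way \<open>p\<^sub>y\<close> vanishes (\<open>gradient_zero_if_load_zero\<close>).  Hence \<open>p\<close> is a constant \<open>t\<close>.  Then the jump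
  \<open>v\<^sub>b - t\<close> on any single edge can be lifted to a field in \<open>V\<close> with normal trace a multiple of that
  jump on this edge and zero on the other three; testing with it shows that the jump vanishes
  (\<open>edge_polynomials_constant_if_load_zero\<close>).  For the Raviart--Thomas space the lifting is
  \<open>((x - e) (v\<^sub>b - t), 0)\<close>; for the BDM space the top degree is only available through a curl, and
  a second component that vanishes on the adjacent edges has to be added
  (\<open>BDM_edge_lifting\<close>).

  Since the discrete gradient is given by a definite description, the argument also needs that the
  defining equation has exactly one solution.  Existence is the Riesz representation theorem on a
  finite-dimensional space, proved by a Gram--Schmidt step in \<open>representation_on_function_span\<close>;
  uniqueness holds because a polynomial that vanishes on an open set is zero.\<close>

section \<open>Representation of linear forms on a space spanned by finitely many functions\<close>

text \<open>Spans, subspaces and linear forms are relative to a set of functions, because the forms in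
  question are integrals, which are additive only on integrable functions.\<close>

definition function_span :: "'i set \<Rightarrow> ('i \<Rightarrow> 'a \<Rightarrow> 'b::real_vector) \<Rightarrow> ('a \<Rightarrow> 'b) set" where
  "function_span I b = {q. \<exists>c. q = (\<lambda>z. \<Sum>i\<in>I. c i *\<^sub>R b i z)}"

definition function_subspace :: "('a \<Rightarrow> 'b::real_vector) set \<Rightarrow> bool" where
  "function_subspace W \<longleftrightarrow> (\<lambda>z. 0) \<in> W \<and> (\<forall>f\<in>W. \<forall>g\<in>W. (\<lambda>z. f z + g z) \<in> W) \<and>
     (\<forall>t. \<forall>f\<in>W. (\<lambda>z. t *\<^sub>R f z) \<in> W)"

definition linear_form :: "('a \<Rightarrow> 'b::real_vector) set \<Rightarrow> (('a \<Rightarrow> 'b) \<Rightarrow> real) \<Rightarrow> bool" where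
  "linear_form W L \<longleftrightarrow> (\<forall>f\<in>W. \<forall>g\<in>W. L (\<lambda>z. f z + g z) = L f + L g) \<and>
     (\<forall>t. \<forall>f\<in>W. L (\<lambda>z. t *\<^sub>R f z) = t * L f)"

lemma function_subspaceD:
  assumes "function_subspace W"
  shows "(\<lambda>z. 0) \<in> W" and "f \<in> W \<Longrightarrow> g \<in> W \<Longrightarrow> (\<lambda>z. f z + g z) \<in> W"
    and "f \<in> W \<Longrightarrow> (\<lambda>z. t *\<^sub>R f z) \<in> W"
  using assms by (auto simp: function_subspace_def)

lemma linear_formD:
  assumes "linear_form W L"
  shows "f \<in> W \<Longrightarrow> g \<in> W \<Longrightarrow> L (\<lambda>z. f z + g z) = L f + L g"
    and "f \<in> W \<Longrightarrow> L (\<lambda>z. t *\<^sub>R f z) = t * L f"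
  using assms by (auto simp: linear_form_def)

lemma function_subspace_function_span: "function_subspace (function_span I b)"
  unfolding function_subspace_def
proof (intro conjI ballI allI)
  show "(\<lambda>z. 0) \<in> function_span I b"
    unfolding function_span_def by (auto intro!: exI[of _ "\<lambda>i. 0"])
next
  fix f g assume "f \<in> function_span I b" "g \<in> function_span I b"
  then obtain c e where "f = (\<lambda>z. \<Sum>i\<in>I. c i *\<^sub>R b i z)" "g = (\<lambda>z. \<Sum>i\<in>I. e i *\<^sub>R b i z)"
    by (auto simp: function_span_def)
  then have "(\<lambda>z. f z + g z) = (\<lambda>z. \<Sum>i\<in>I. (c i + e i) *\<^sub>R b i z)"
    by (simp add: scaleR_add_left sum.distrib)
  then show "(\<lambda>z. f z + g z) \<in> function_span I b"
    unfolding function_span_def by (intro CollectI exI)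
next
  fix t f assume "f \<in> function_span I b"
  then obtain c where "f = (\<lambda>z. \<Sum>i\<in>I. c i *\<^sub>R b i z)"
    by (auto simp: function_span_def)
  then have "(\<lambda>z. t *\<^sub>R f z) = (\<lambda>z. \<Sum>i\<in>I. (t * c i) *\<^sub>R b i z)"
    by (simp add: scaleR_sum_right)
  then show "(\<lambda>z. t *\<^sub>R f z) \<in> function_span I b"
    unfolding function_span_def by (intro CollectI exI)
qed

lemma function_span_subset:
  assumes W: "function_subspace W" and "finite I" and "\<And>i. i \<in> I \<Longrightarrow> b i \<in> W"
  shows "function_span I b \<subseteq> W"
proof -
  have "(\<lambda>z. \<Sum>i\<in>I. c i *\<^sub>R b i z) \<in> W" for c
    using assms(2,3)
  proof (induction I rule: finite_induct)
    case empty
    then show ?case using function_subspaceD(1)[OF W] by simp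
  next
    case (insert i I)
    then show ?case
      using function_subspaceD(2)[OF W function_subspaceD(3)[OF W, of "b i" "c i"], of "\<lambda>z. \<Sum>i\<in>I. c i *\<^sub>R b i z"]
      by simp
  qed
  then show ?thesis by (auto simp: function_span_def)
qed

lemma function_span_insert:
  assumes "finite I" "i \<notin> I"
  shows "function_span (insert i I) b = {\<lambda>z. q z + t *\<^sub>R b i z | q t. q \<in> function_span I b}"
proof (intro equalityI subsetI)
  fix f assume "f \<in> function_span (insert i I) b"
  then obtain c where "f = (\<lambda>z. (\<Sum>k\<in>I. c k *\<^sub>R b k z) + c i *\<^sub>R b i z)"
    using assms by (auto simp: function_span_def add.commute)
  then show "f \<in> {\<lambda>z. q z + t *\<^sub>R b i z | q t. q \<in> function_span I b}"
    by (auto simp: function_span_def)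
next
  fix f assume "f \<in> {\<lambda>z. q z + t *\<^sub>R b i z | q t. q \<in> function_span I b}"
  then obtain c t where f: "f = (\<lambda>z. (\<Sum>k\<in>I. c k *\<^sub>R b k z) + t *\<^sub>R b i z)"
    by (auto simp: function_span_def)
  have "(\<Sum>k\<in>insert i I. (c(i := t)) k *\<^sub>R b k z) = f z" for z
  proof -
    have "(\<Sum>k\<in>I. (c(i := t)) k *\<^sub>R b k z) = (\<Sum>k\<in>I. c k *\<^sub>R b k z)"
      using assms by (intro sum.cong) auto
    then show ?thesis using assms f by (simp add: add.commute)
  qed
  then have "f = (\<lambda>z. \<Sum>k\<in>insert i I. (c(i := t)) k *\<^sub>R b k z)"
    by auto
  then show "f \<in> function_span (insert i I) b"
    unfolding function_span_def by (intro CollectI exI)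
qed

text \<open>The step from \<open>I\<close> to \<open>insert i I\<close> is one step of the Gram--Schmidt process: subtracting from
  \<open>b i\<close> its projection onto the old span leaves a function orthogonal to that span, and
  the representative changes by a multiple of it.\<close>

lemma representation_on_function_span:
  assumes W: "function_subspace W" and "finite I" and "\<And>i. i \<in> I \<Longrightarrow> b i \<in> W"
    and B: "\<And>f. f \<in> W \<Longrightarrow> linear_form W (B f)"
    and sym: "\<And>f g. f \<in> W \<Longrightarrow> g \<in> W \<Longrightarrow> B f g = B g f"
    and definite: "\<And>f. f \<in> W \<Longrightarrow> B f f = 0 \<Longrightarrow> f = (\<lambda>z. 0)"
    and "linear_form W L"
  shows "\<exists>g\<in>function_span I b. \<forall>q\<in>function_span I b. B g q = L q"
  using assms(2,3) \<open>linear_form W L\<close>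
proof (induction I arbitrary: L rule: finite_induct)
  case empty
  have "L (\<lambda>z. 0) = 0"
    using linear_formD(2)[OF empty.prems(2) function_subspaceD(1)[OF W], of 0] by simp
  moreover have "B (\<lambda>z. 0) (\<lambda>z. 0) = 0"
    using linear_formD(2)[OF B function_subspaceD(1)[OF W], OF function_subspaceD(1)[OF W], of 0] by simp
  ultimately show ?case
    by (simp add: function_span_def)
next
  case (insert i I)
  let ?S = "function_span I b"
  note S = function_subspaceD[OF function_subspace_function_span]
  note WD = function_subspaceD[OF W]
  have SW: "?S \<subseteq> W"
    using function_span_subset[OF W insert.hyps(1), of b] insert.prems(1) by simp
  have bi: "b i \<in> W" using insert by auto
  obtain g where g: "g \<in> ?S" "\<forall>q\<in>?S. B g q = L q"
    using insert.IH[OF _ insert.prems(2)] insert.prems(1) by auto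
  obtain h where h: "h \<in> ?S" "\<forall>q\<in>?S. B h q = B (b i) q"
    using insert.IH[OF _ B[OF bi]] insert.prems by auto
  \<comment> \<open>\<open>h\<close> is the projection of \<open>b i\<close> onto the old span, and \<open>f\<close> the orthogonal remainder.\<close>
  define f where "f = (\<lambda>z. b i z + (-1) *\<^sub>R h z)"
  have hW: "h \<in> W" and gW: "g \<in> W" using h g SW by auto
  have fW: "f \<in> W" unfolding f_def by (intro WD bi hW)
  have orth: "B f q = 0" if "q \<in> ?S" for q
  proof -
    have q: "q \<in> W" using that SW by auto
    have "B q f = B q (b i) + (-1) * B q h"
      unfolding f_def using linear_formD[OF B[OF q]] bi hW WD(3)[OF hW] by metis
    then show ?thesis
      using h(2) that sym q fW bi hW by simp
  qed
  \<comment> \<open>If \<open>b i\<close> already lies in the old span, then \<open>f = 0\<close>, and division by zero gives \<open>s = 0\<close>.\<close>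
  define s where "s = L f / B f f"
  have s: "s * B f f = L f"
  proof (cases "B f f = 0")
    case True
    then have "f = (\<lambda>z. 0)" using definite fW by blast
    then have "L f = 0"
      using linear_formD(2)[OF insert.prems(2) WD(1), of 0] by simp
    then show ?thesis using True by simp
  qed (simp add: s_def)
  define G where "G = (\<lambda>z. g z + s *\<^sub>R f z)"
  have GW: "G \<in> W" unfolding G_def by (intro WD gW fW)
  have "G = (\<lambda>z. (g z + (-s) *\<^sub>R h z) + s *\<^sub>R b i z)"
    by (auto simp: G_def f_def algebra_simps)
  moreover have "(\<lambda>z. g z + (-s) *\<^sub>R h z) \<in> ?S"
    by (intro S g h)
  ultimately have G: "G \<in> function_span (insert i I) b"
    unfolding function_span_insert[OF insert.hyps] by (intro CollectI exI conjI)
  have "B G q = L q" if q: "q \<in> function_span (insert i I) b" for q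
  proof -
    obtain q' t where q': "q' \<in> ?S" and q_eq: "q = (\<lambda>z. q' z + t *\<^sub>R b i z)"
      using q unfolding function_span_insert[OF insert.hyps] by blast
    define r where "r = (\<lambda>z. q' z + t *\<^sub>R h z)"
    have r: "r \<in> ?S" unfolding r_def by (intro S q' h)
    have rW: "r \<in> W" using r SW by auto
    have qr: "q = (\<lambda>z. r z + t *\<^sub>R f z)"
      by (auto simp: q_eq r_def f_def algebra_simps)
    have 1: "B G q = B G r + t * B G f"
      unfolding qr using linear_formD[OF B[OF GW]] rW fW WD(3)[OF fW] by metis
    have 2: "B G x = B g x + s * B f x" if x: "x \<in> W" for x
    proof -
      have "B x G = B x g + s * B x f"
        unfolding G_def using linear_formD[OF B[OF x]] gW fW WD(3)[OF fW] by metis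
      then show ?thesis using sym x gW fW GW by simp
    qed
    have "B g f = 0" using orth[OF g(1)] sym gW fW by simp
    then have "B G q = L r + t * L f"
      unfolding 1 2[OF rW] 2[OF fW] using g(2) r orth s by simp
    also have "\<dots> = L q"
      unfolding qr using linear_formD[OF insert.prems(2)] rW fW WD(3)[OF fW] by metis
    finally show ?thesis .
  qed
  with G show ?case by blast
qed

section \<open>Polynomial functions on the plane\<close>

lemma polynomial_field_iff:
  fixes q :: vfield
  shows "polynomial_function q \<longleftrightarrow>
    real_polynomial_function (\<lambda>z. fst (q z)) \<and> real_polynomial_function (\<lambda>z. snd (q z))"
  by (auto simp: polynomial_function_iff_Basis_inner Basis_prod_def inner_prod_def)

lemma polynomial_fields_subspace: "function_subspace {q :: vfield. polynomial_function q}"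
  by (auto simp: function_subspace_def)

lemma real_polynomial_function_continuous_on:
  "real_polynomial_function f \<Longrightarrow> continuous_on S f"
  by (simp add: continuous_at_imp_continuous_on continuous_real_polymonial_function)

lemma real_polynomial_function_fst_snd:
  "real_polynomial_function (fst :: point \<Rightarrow> real)" "real_polynomial_function (snd :: point \<Rightarrow> real)"
  by (intro real_polynomial_function.intros bounded_linear_fst bounded_linear_snd)+

lemma real_polynomial_function_slice:
  fixes f :: "point \<Rightarrow> real"
  assumes "real_polynomial_function f"
  shows "real_polynomial_function (\<lambda>x. f (x, y))" "real_polynomial_function (\<lambda>y. f (x, y))"
proof -
  have "polynomial_function (\<lambda>x::real. (x, y))" "polynomial_function (\<lambda>y::real. (x, y))"
    by (auto simp: polynomial_function_iff_Basis_inner Basis_prod_def inner_prod_def)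
  from this[THEN real_polynomial_function_compose, OF assms]
  show "real_polynomial_function (\<lambda>x. f (x, y))" "real_polynomial_function (\<lambda>y. f (x, y))"
    by (simp_all add: o_def)
qed

lemma real_polynomial_function_poly:
  fixes p :: "real poly"
  shows "real_polynomial_function (poly p)"
proof -
  have "poly p = (\<lambda>x. \<Sum>i\<le>degree p. coeff p i * x ^ i)"
    by (rule ext) (rule poly_altdef)
  then show ?thesis
    unfolding real_polynomial_function_iff_sum by (intro exI)
qed

text \<open>Restricted to a line through a point of the open set, the function is a univariate
  polynomial with infinitely many roots.\<close>

lemma real_polynomial_function_zero_on_open:
  fixes f :: "'a::real_normed_vector \<Rightarrow> real"
  assumes f: "real_polynomial_function f" and "open U" "z0 \<in> U" and 0: "\<And>z. z \<in> U \<Longrightarrow> f z = 0"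
  shows "f z = 0"
proof -
  define l where "l t = z0 + t *\<^sub>R (z - z0)" for t :: real
  have "polynomial_function l"
    unfolding l_def
    by (intro polynomial_function_add polynomial_function_const polynomial_function_bounded_linear bounded_linear_scaleR_left)
  then have "real_polynomial_function (f \<circ> l)"
    using f by blast
  then obtain a n where an: "f \<circ> l = (\<lambda>t. \<Sum>i\<le>n. a i * t ^ i)"
    unfolding real_polynomial_function_iff_sum by blast
  define p where "p = (\<Sum>i\<le>n. monom (a i) i)"
  have p: "f (l t) = poly p t" for t
    using fun_cong[OF an, of t] by (simp add: p_def poly_sum poly_monom)
  have "continuous_on UNIV l"
    unfolding l_def by (intro continuous_intros)
  then have "open (l -` U)"
    using \<open>open U\<close> by (simp add: open_vimage)
  moreover have "0 \<in> l -` U" using \<open>z0 \<in> U\<close> by (simp add: l_def)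
  ultimately have "infinite (l -` U)"
    using finite_imp_not_open by blast
  moreover have "l -` U \<subseteq> {t. poly p t = 0}"
    using 0 by (simp add: subset_iff flip: p)
  ultimately have "p = 0"
    using poly_roots_finite finite_subset by blast
  then show ?thesis
    using p[of 1] by (simp add: l_def)
qed

text \<open>Polynomial functions are generated from linear ones by sums and products, so the usual
  differentiation rules produce a polynomial partial derivative.\<close>

lemma ex_partial_x:
  fixes f :: "point \<Rightarrow> real"
  assumes "real_polynomial_function f"
  shows "\<exists>f'. real_polynomial_function f' \<and>
    (\<forall>x y. ((\<lambda>x. f (x, y)) has_real_derivative f' (x, y)) (at x))"
  using assms
proof (induction f rule: real_polynomial_function.induct)
  case (linear f)
  interpret bounded_linear f by fact
  have "f (x, y) = x * f (1, 0) + f (0, y)" for x y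
  proof -
    have "f (x, y) = f (x *\<^sub>R (1, 0) + (0, y))" by simp
    also have "\<dots> = x * f (1, 0) + f (0, y)" unfolding add scaleR by simp
    finally show ?thesis .
  qed
  then have "(\<lambda>x. f (x, y)) = (\<lambda>x. x * f (1, 0) + f (0, y))" for y
    by blast
  moreover have "((\<lambda>x. x * f (1, 0) + f (0, y)) has_real_derivative f (1, 0)) (at x)" for x y
    by (auto intro!: derivative_eq_intros)
  ultimately have "((\<lambda>x. f (x, y)) has_real_derivative f (1, 0)) (at x)" for x y
    by metis
  then show ?case
    by (intro exI[of _ "\<lambda>z. f (1, 0)"]) (auto intro: real_polynomial_function.intros)
next
  case (const c)
  have "\<forall>x y. ((\<lambda>x. c) has_real_derivative (\<lambda>z. 0) (x, y)) (at x)"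
    by auto
  then show ?case by blast
next
  case (add f g)
  then obtain f' g' where "real_polynomial_function f'" "real_polynomial_function g'"
    "\<forall>x y. ((\<lambda>x. f (x, y)) has_real_derivative f' (x, y)) (at x)"
    "\<forall>x y. ((\<lambda>x. g (x, y)) has_real_derivative g' (x, y)) (at x)" by blast
  then show ?case
    by (intro exI[of _ "\<lambda>z. f' z + g' z"]) (auto intro!: DERIV_add)
next
  case (mult f g)
  then obtain f' g' where "real_polynomial_function f'" "real_polynomial_function g'"
    "\<forall>x y. ((\<lambda>x. f (x, y)) has_real_derivative f' (x, y)) (at x)"
    "\<forall>x y. ((\<lambda>x. g (x, y)) has_real_derivative g' (x, y)) (at x)" by blast
  with mult show ?case
    by (intro exI[of _ "\<lambda>z. f' z * g z + g' z * f z"]) (auto intro!: DERIV_mult)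
qed

lemma partial_x_eqI:
  "((\<lambda>x. f (x, y)) has_real_derivative D) (at x) \<Longrightarrow> partial_x f (x, y) = D"
  unfolding partial_x_def by (simp add: DERIV_imp_deriv)

lemma partial_y_eqI:
  "((\<lambda>y. f (x, y)) has_real_derivative D) (at y) \<Longrightarrow> partial_y f (x, y) = D"
  unfolding partial_y_def by (simp add: DERIV_imp_deriv)

lemma partial_x_polynomial:
  fixes f :: "point \<Rightarrow> real"
  assumes "real_polynomial_function f"
  shows "((\<lambda>x. f (x, y)) has_real_derivative partial_x f (x, y)) (at x)"
    and "real_polynomial_function (partial_x f)"
proof -
  obtain f' where f': "real_polynomial_function f'"
    "\<And>x y. ((\<lambda>x. f (x, y)) has_real_derivative f' (x, y)) (at x)"
    using ex_partial_x[OF assms] by blast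
  have "partial_x f = f'"
    using partial_x_eqI[of f, OF f'(2)] by auto
  with f' show "((\<lambda>x. f (x, y)) has_real_derivative partial_x f (x, y)) (at x)"
    and "real_polynomial_function (partial_x f)" by simp_all
qed

text \<open>Exchanging the coordinates turns statements about \<open>partial_x\<close> into statements about
  \<open>partial_y\<close>.\<close>

lemma real_polynomial_function_swap:
  fixes f :: "point \<Rightarrow> real"
  assumes "real_polynomial_function f"
  shows "real_polynomial_function (\<lambda>z. f (prod.swap z))"
proof -
  have "polynomial_function (prod.swap :: point \<Rightarrow> point)"
    using real_polynomial_function_fst_snd by (simp add: polynomial_field_iff)
  from real_polynomial_function_compose[OF this assms] show ?thesis
    by (simp add: o_def)
qed

lemma partial_y_swap: "partial_y f z = partial_x (\<lambda>z. f (prod.swap z)) (prod.swap z)"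
  by (simp add: partial_x_def partial_y_def)

lemma partial_y_polynomial:
  fixes f :: "point \<Rightarrow> real"
  assumes "real_polynomial_function f"
  shows "((\<lambda>y. f (x, y)) has_real_derivative partial_y f (x, y)) (at y)"
    and "real_polynomial_function (partial_y f)"
proof -
  note swapped = partial_x_polynomial[OF real_polynomial_function_swap[OF assms]]
  show "((\<lambda>y. f (x, y)) has_real_derivative partial_y f (x, y)) (at y)"
    using swapped(1) by (simp add: partial_y_swap)
  show "real_polynomial_function (partial_y f)"
    using real_polynomial_function_swap[OF swapped(2)] unfolding partial_y_swap .
qed

section \<open>Integration over a rectangle\<close>

lemma real_polynomial_function_integrable:
  fixes f :: "'a::euclidean_space \<Rightarrow> real"
  assumes "real_polynomial_function f"
  shows "f integrable_on cbox a b"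
  using assms by (intro integrable_continuous real_polynomial_function_continuous_on)

text \<open>Fubini's theorem with the inner integral in the direction of differentiation, followed by the
  fundamental theorem of calculus.\<close>

lemma integral_partial_y:
  fixes f :: "point \<Rightarrow> real"
  assumes f: "real_polynomial_function f" and "c \<le> d"
  shows "integral (cbox (a, c) (b, d)) (partial_y f) = integral {a..b} (\<lambda>x. f (x, d) - f (x, c))"
proof -
  have "integral {c..d} (\<lambda>y. partial_y f (x, y)) = f (x, d) - f (x, c)" for x
    using partial_y_polynomial(1)[OF f] \<open>c \<le> d\<close>
    by (intro integral_unique fundamental_theorem_of_calculus)
      (auto simp: has_real_derivative_iff_has_vector_derivative[symmetric] intro: has_field_derivative_at_within)
  then show ?thesis
    using integral_prod_continuous[OF real_polynomial_function_continuous_on[OF partial_y_polynomial(2)[OF f]]]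
    by simp
qed

lemma integral_partial_x:
  fixes f :: "point \<Rightarrow> real"
  assumes f: "real_polynomial_function f" and "a \<le> b"
  shows "integral (cbox (a, c) (b, d)) (partial_x f) = integral {c..d} (\<lambda>y. f (b, y) - f (a, y))"
proof -
  note swapped = real_polynomial_function_swap[OF f]
  have px: "partial_x f = (\<lambda>(x, y). partial_y (\<lambda>z. f (prod.swap z)) (y, x))"
    by (simp add: fun_eq_iff partial_y_swap)
  have "continuous_on (cbox (a, c) (b, d)) (partial_x f)"
    by (intro real_polynomial_function_continuous_on partial_x_polynomial f)
  then have "integral (cbox (a, c) (b, d)) (partial_x f) =
      integral (cbox (c, a) (d, b)) (\<lambda>(x, y). partial_y (\<lambda>z. f (prod.swap z)) (x, y))"
    unfolding px by (rule integral_swap_2dim)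
  also have "\<dots> = integral {c..d} (\<lambda>y. f (b, y) - f (a, y))"
    using integral_partial_y[OF swapped \<open>a \<le> b\<close>, of c d] by (simp add: case_prod_beta')
  finally show ?thesis .
qed

lemma divergence_polynomial:
  assumes "polynomial_function q"
  shows "real_polynomial_function (divergence q)"
  using assms unfolding polynomial_field_iff divergence_def[abs_def]
  by (auto intro!: real_polynomial_function.intros(3) partial_x_polynomial partial_y_polynomial)

lemma partial_x_add:
  assumes "real_polynomial_function f" "real_polynomial_function g"
  shows "partial_x (\<lambda>z. f z + g z) z = partial_x f z + partial_x g z"
  using partial_x_eqI[OF DERIV_add[OF assms[THEN partial_x_polynomial(1)]]] by (cases z) auto

lemma partial_y_add:
  assumes "real_polynomial_function f" "real_polynomial_function g"
  shows "partial_y (\<lambda>z. f z + g z) z = partial_y f z + partial_y g z"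
  using partial_y_eqI[OF DERIV_add[OF assms[THEN partial_y_polynomial(1)]]] by (cases z) auto

lemma partial_x_mult:
  assumes "real_polynomial_function f" "real_polynomial_function g"
  shows "partial_x (\<lambda>z. f z * g z) z = partial_x f z * g z + partial_x g z * f z"
  using partial_x_eqI[OF DERIV_mult[OF assms[THEN partial_x_polynomial(1)]]] by (cases z) auto

lemma partial_y_mult:
  assumes "real_polynomial_function f" "real_polynomial_function g"
  shows "partial_y (\<lambda>z. f z * g z) z = partial_y f z * g z + partial_y g z * f z"
  using partial_y_eqI[OF DERIV_mult[OF assms[THEN partial_y_polynomial(1)]]] by (cases z) auto

lemma partial_const: "partial_x (\<lambda>z. t) z = 0" "partial_y (\<lambda>z. t) z = 0"
  by (simp_all add: partial_x_def partial_y_def)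

lemma divergence_add:
  assumes "polynomial_function f" "polynomial_function g"
  shows "divergence (\<lambda>z. f z + g z) z = divergence f z + divergence g z"
  using assms unfolding polynomial_field_iff divergence_def
  by (simp add: partial_x_add partial_y_add)

lemma divergence_scale:
  assumes "polynomial_function f"
  shows "divergence (\<lambda>z. t *\<^sub>R f z) z = t * divergence f z"
  using assms unfolding polynomial_field_iff divergence_def
  by (simp add: partial_x_mult partial_y_mult partial_const real_polynomial_function.intros distrib_left)

text \<open>The divergence theorem for the field \<open>p q\<close>, applied to its two components separately.\<close>

lemma green_formula:
  assumes p: "real_polynomial_function p" and q: "polynomial_function q" and "a \<le> b" "c \<le> d"
  shows "integral (cbox (a, c) (b, d)) (\<lambda>z. p z * divergence q z) +
      integral (cbox (a, c) (b, d)) (\<lambda>z. partial_x p z * fst (q z) + partial_y p z * snd (q z)) =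
      integral {c..d} (\<lambda>y. p (b, y) * fst (q (b, y)) - p (a, y) * fst (q (a, y))) +
      integral {a..b} (\<lambda>x. p (x, d) * snd (q (x, d)) - p (x, c) * snd (q (x, c)))"
    (is "integral ?K ?f + integral ?K ?g = _")
proof -
  let ?F = "\<lambda>z. p z * fst (q z)" and ?G = "\<lambda>z. p z * snd (q z)"
  have q12: "real_polynomial_function (\<lambda>z. fst (q z))" "real_polynomial_function (\<lambda>z. snd (q z))"
    using q by (auto simp: polynomial_field_iff)
  have FG: "real_polynomial_function ?F" "real_polynomial_function ?G"
    using p q12 by auto
  have "?f integrable_on ?K" "?g integrable_on ?K"
    using p q12 divergence_polynomial[OF q] partial_x_polynomial(2)[OF p] partial_y_polynomial(2)[OF p]
    by (auto intro!: real_polynomial_function_integrable)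
  then have "integral ?K ?f + integral ?K ?g = integral ?K (\<lambda>z. ?f z + ?g z)"
    by (rule integral_add[symmetric])
  also have "(\<lambda>z. ?f z + ?g z) = (\<lambda>z. partial_x ?F z + partial_y ?G z)"
    using p q12 by (simp add: fun_eq_iff divergence_def partial_x_mult partial_y_mult algebra_simps)
  also have "integral ?K \<dots> = integral ?K (partial_x ?F) + integral ?K (partial_y ?G)"
    by (intro integral_add real_polynomial_function_integrable partial_x_polynomial partial_y_polynomial FG)
  finally show ?thesis
    using integral_partial_x[OF FG(1) \<open>a \<le> b\<close>] integral_partial_y[OF FG(2) \<open>c \<le> d\<close>] by simp
qed

lemma integral_linepath_real:
  fixes g :: "real \<Rightarrow> real"
  assumes "c < d" and "g integrable_on {c..d}"
  shows "(d - c) * integral {0..1} (\<lambda>t. g ((d - c) * t + c)) = integral {c..d} g"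
proof -
  have "(g has_integral integral {c..d} g) (cbox c d)"
    using assms by auto
  from has_integral_affinity'[OF this, of "d - c" c]
  have "((\<lambda>t. g ((d - c) * t + c)) has_integral integral {c..d} g / (d - c)) {0..1}"
    using \<open>c < d\<close> by (simp add: field_simps)
  then show ?thesis
    using \<open>c < d\<close> by (auto dest: integral_unique)
qed

lemma segment_integral_vertical:
  assumes "c < d" and "g integrable_on {c..d}" and fg: "\<And>y. y \<in> {c..d} \<Longrightarrow> f (x, y) = g y"
  shows "segment_integral (x, c) (x, d) f = integral {c..d} g"
proof -
  have "f (linepath (x, c) (x, d) t) = g ((d - c) * t + c)" if "t \<in> {0..1}" for t
  proof -
    have "linepath (x, c) (x, d) t = (x, (d - c) * t + c)"
      by (simp add: linepath_def algebra_simps)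
    moreover have "(d - c) * t + c \<in> {c..d}"
    proof -
      have "0 \<le> (d - c) * t" "(d - c) * t \<le> d - c"
        using that \<open>c < d\<close> by (auto intro: mult_left_le)
      then show ?thesis unfolding atLeastAtMost_iff by linarith
    qed
    ultimately show ?thesis using fg by simp
  qed
  then have "integral {0..1} (\<lambda>t. f (linepath (x, c) (x, d) t)) = integral {0..1} (\<lambda>t. g ((d - c) * t + c))"
    by (intro integral_cong) auto
  then show ?thesis
    using integral_linepath_real[OF assms(1,2)] \<open>c < d\<close>
    by (simp add: segment_integral_def norm_Pair)
qed

lemma segment_integral_horizontal:
  assumes "a < b" and "g integrable_on {a..b}" and fg: "\<And>x. x \<in> {a..b} \<Longrightarrow> f (x, y) = g x"
  shows "segment_integral (a, y) (b, y) f = integral {a..b} g"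
proof -
  have "f (linepath (a, y) (b, y) t) = g ((b - a) * t + a)" if "t \<in> {0..1}" for t
  proof -
    have "linepath (a, y) (b, y) t = ((b - a) * t + a, y)"
      by (simp add: linepath_def algebra_simps)
    moreover have "(b - a) * t + a \<in> {a..b}"
    proof -
      have "0 \<le> (b - a) * t" "(b - a) * t \<le> b - a"
        using that \<open>a < b\<close> by (auto intro: mult_left_le)
      then show ?thesis unfolding atLeastAtMost_iff by linarith
    qed
    ultimately show ?thesis using fg by simp
  qed
  then have "integral {0..1} (\<lambda>t. f (linepath (a, y) (b, y) t)) = integral {0..1} (\<lambda>t. g ((b - a) * t + a))"
    by (intro integral_cong) auto
  then show ?thesis
    using integral_linepath_real[OF assms(1,2)] \<open>a < b\<close>
    by (simp add: segment_integral_def norm_Pair)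
qed

section \<open>Weak functions on one rectangle\<close>

fun edge_coordinate :: "side \<Rightarrow> point \<Rightarrow> real" where
  "edge_coordinate West z = snd z"
| "edge_coordinate East z = snd z"
| "edge_coordinate South z = fst z"
| "edge_coordinate North z = fst z"

lemma side_vertices_cbox:
  fixes a b c d :: real
  assumes "a < b" "c < d"
  shows "side_start (cbox (a, c) (b, d)) West = (a, c)" "side_end (cbox (a, c) (b, d)) West = (a, d)"
    "side_start (cbox (a, c) (b, d)) East = (b, c)" "side_end (cbox (a, c) (b, d)) East = (b, d)"
    "side_start (cbox (a, c) (b, d)) South = (a, c)" "side_end (cbox (a, c) (b, d)) South = (b, c)"
    "side_start (cbox (a, c) (b, d)) North = (a, d)" "side_end (cbox (a, c) (b, d)) North = (b, d)"
proof -
  have le: "\<forall>i\<in>Basis. (a, c) \<bullet> i \<le> (b, d) \<bullet> i"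
    using assms by (auto simp: Basis_prod_def inner_prod_def)
  show "side_start (cbox (a, c) (b, d)) West = (a, c)" "side_end (cbox (a, c) (b, d)) West = (a, d)"
    "side_start (cbox (a, c) (b, d)) East = (b, c)" "side_end (cbox (a, c) (b, d)) East = (b, d)"
    "side_start (cbox (a, c) (b, d)) South = (a, c)" "side_end (cbox (a, c) (b, d)) South = (b, c)"
    "side_start (cbox (a, c) (b, d)) North = (a, d)" "side_end (cbox (a, c) (b, d)) North = (b, d)"
    using interval_lowerbound[OF le] interval_upperbound[OF le] by simp_all
qed

lemma closed_segment_axis_parallel:
  fixes x y c d :: real
  assumes "c \<le> d"
  shows "closed_segment (x, c) (x, d) = {x} \<times> {c..d}" "closed_segment (c, y) (d, y) = {c..d} \<times> {y}"
proof -
  have "z \<in> closed_segment (x, c) (x, d) \<longleftrightarrow> fst z = x \<and> snd z \<in> closed_segment c d" for z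
    by (cases z) (auto simp: in_segment algebra_simps)
  then show "closed_segment (x, c) (x, d) = {x} \<times> {c..d}"
    using assms by (auto simp: closed_segment_eq_real_ivl1)
  have "z \<in> closed_segment (c, y) (d, y) \<longleftrightarrow> snd z = y \<and> fst z \<in> closed_segment c d" for z
    by (cases z) (auto simp: in_segment algebra_simps)
  then show "closed_segment (c, y) (d, y) = {c..d} \<times> {y}"
    using assms by (auto simp: closed_segment_eq_real_ivl1)
qed

lemma edge_cbox:
  fixes a b c d :: real
  assumes "a < b" "c < d"
  shows "edge (cbox (a, c) (b, d)) West = {a} \<times> {c..d}" "edge (cbox (a, c) (b, d)) East = {b} \<times> {c..d}"
    "edge (cbox (a, c) (b, d)) South = {a..b} \<times> {c}" "edge (cbox (a, c) (b, d)) North = {a..b} \<times> {d}"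
  using assms
  by (simp_all only: edge_def side_vertices_cbox[OF assms] closed_segment_axis_parallel less_imp_le)

text \<open>The affine parameter in \<open>P_edge\<close> may run along the edge in either direction and start at
  either end, so it is replaced here by the coordinate of the plane along the edge.\<close>

lemma P_edge_as_poly_of_coordinate:
  assumes "a < b" "c < d" and g: "g \<in> P_edge k (edge (cbox (a, c) (b, d)) s)"
  obtains r where "degree r \<le> k"
    "\<And>z. z \<in> edge (cbox (a, c) (b, d)) s \<Longrightarrow> g z = poly r (edge_coordinate s z)"
proof -
  let ?F = "edge (cbox (a, c) (b, d)) s" and ?e = "edge_coordinate s"
  obtain u w p where F: "?F = closed_segment u w" and p: "degree p \<le> k"
    "\<And>t. t \<in> {0..1} \<Longrightarrow> g (linepath u w t) = poly p t"
    using g unfolding P_edge_def by blast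
  have lin: "?e (linepath u w t) = ?e u + t * (?e w - ?e u)" for t
    by (cases s) (simp_all add: linepath_def algebra_simps)
  have ne: "?e w \<noteq> ?e u"
  proof
    assume eq: "?e w = ?e u"
    have const: "?e z = ?e u" if "z \<in> ?F" for z
      using that lin eq unfolding F linepath_image_01[symmetric] by auto
    define z1 where "z1 = side_start (cbox (a, c) (b, d)) s"
    define z2 where "z2 = side_end (cbox (a, c) (b, d)) s"
    have "z1 \<in> ?F" "z2 \<in> ?F" by (auto simp: edge_def z1_def z2_def)
    then have "?e z1 = ?e z2" using const by simp
    then show False
      unfolding z1_def z2_def
      by (cases s) (use side_vertices_cbox[OF assms(1,2)] assms(1,2) in \<open>simp_all del: side_start.simps side_end.simps\<close>)
  qed
  define r where "r = pcompose p [:- ?e u / (?e w - ?e u), 1 / (?e w - ?e u):]"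
  show thesis
  proof
    show "degree r \<le> k"
      using p(1) ne by (simp add: r_def degree_pcompose)
    fix z assume "z \<in> ?F"
    then obtain t where t: "t \<in> {0..1}" "z = linepath u w t"
      unfolding F linepath_image_01[symmetric] by blast
    have "- ?e u / (?e w - ?e u) + ?e z * (1 / (?e w - ?e u)) = t"
      unfolding t(2) lin using ne by (simp add: add_divide_distrib)
    then show "g z = poly r (?e z)"
      using p(2) t by (simp add: r_def poly_pcompose)
  qed
qed

text \<open>The right-hand side of the equation defining the discrete gradient on the rectangle with
  corners \<open>(a, c)\<close> and \<open>(b, d)\<close>, once the interior value is the polynomial \<open>p\<close> and the value on
  the edge \<open>s\<close> is \<open>r s\<close>, as a polynomial of the coordinate along that edge.\<close>

definition load :: "real \<Rightarrow> real \<Rightarrow> real \<Rightarrow> real \<Rightarrow> (point \<Rightarrow> real) \<Rightarrow> (side \<Rightarrow> real poly) \<Rightarrow> vfield \<Rightarrow> real" where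
  "load a b c d p r q = - integral (cbox (a, c) (b, d)) (\<lambda>z. p z * divergence q z) +
     (integral {c..d} (\<lambda>y. poly (r East) y * fst (q (b, y)) - poly (r West) y * fst (q (a, y))) +
      integral {a..b} (\<lambda>x. poly (r North) x * snd (q (x, d)) - poly (r South) x * snd (q (x, c))))"

lemma polynomial_field_slices_integrable:
  fixes q :: vfield
  assumes "polynomial_function q"
  shows "(\<lambda>y. poly r y * fst (q (x, y))) integrable_on {c..d}"
    "(\<lambda>x. poly r x * snd (q (x, y))) integrable_on {a..b}"
proof -
  have q: "real_polynomial_function (\<lambda>z. fst (q z))" "real_polynomial_function (\<lambda>z. snd (q z))"
    using assms by (auto simp: polynomial_field_iff)
  have "real_polynomial_function (\<lambda>y. poly r y * fst (q (x, y)))" "real_polynomial_function (\<lambda>x. poly r x * snd (q (x, y)))"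
    using real_polynomial_function_poly[of r] real_polynomial_function_slice[OF q(1)] real_polynomial_function_slice[OF q(2)]
    by (auto intro: real_polynomial_function.intros)
  then show "(\<lambda>y. poly r y * fst (q (x, y))) integrable_on {c..d}"
    "(\<lambda>x. poly r x * snd (q (x, y))) integrable_on {a..b}"
    by (metis real_polynomial_function_integrable box_real(2))+
qed

text \<open>The boundary of the rectangle is negligible, so a weak function enters the volume integral
  only through its values in the interior.\<close>

lemma load_eq_right_hand_side:
  assumes "a < b" "c < d" and K: "K = cbox (a, c) (b, d)"
    and v0: "\<And>z. z \<in> interior K \<Longrightarrow> v0 z = p z"
    and vb: "\<And>s z. z \<in> edge K s \<Longrightarrow> vb (edge K s) z = poly (r s) (edge_coordinate s z)"
    and q: "polynomial_function q"
  shows "- integral K (\<lambda>z. v0 z * divergence q z) + boundary_flux vb q K = load a b c d p r q"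
proof -
  note int = polynomial_field_slices_integrable[OF q]
  note V = side_vertices_cbox[OF assms(1,2), folded K]
  note E = edge_cbox[OF assms(1,2), folded K]
  have "integral K (\<lambda>z. v0 z * divergence q z) = integral K (\<lambda>z. p z * divergence q z)"
  proof (rule integral_spike)
    show "negligible (cbox (a, c) (b, d) - box (a, c) (b, d))"
      by (rule negligible_frontier_interval)
    show "\<And>z. z \<in> K - (cbox (a, c) (b, d) - box (a, c) (b, d)) \<Longrightarrow> p z * divergence q z = v0 z * divergence q z"
      using v0 by (simp add: K)
  qed
  moreover have "boundary_flux vb q K =
    integral {c..d} (\<lambda>y. - (poly (r West) y * fst (q (a, y)))) + integral {c..d} (\<lambda>y. poly (r East) y * fst (q (b, y))) +
    (integral {a..b} (\<lambda>x. - (poly (r South) x * snd (q (x, c)))) + integral {a..b} (\<lambda>x. poly (r North) x * snd (q (x, d))))"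
  proof -
    have "segment_integral (a, c) (a, d) (\<lambda>z. vb (edge K West) z * (q z \<bullet> outward_normal West)) =
        integral {c..d} (\<lambda>y. - (poly (r West) y * fst (q (a, y))))"
      using vb[of _ West] E int
      by (intro segment_integral_vertical assms) (auto simp: inner_prod_def intro: integrable_neg)
    moreover have "segment_integral (b, c) (b, d) (\<lambda>z. vb (edge K East) z * (q z \<bullet> outward_normal East)) =
        integral {c..d} (\<lambda>y. poly (r East) y * fst (q (b, y)))"
      using vb[of _ East] E int
      by (intro segment_integral_vertical assms) (auto simp: inner_prod_def)
    moreover have "segment_integral (a, c) (b, c) (\<lambda>z. vb (edge K South) z * (q z \<bullet> outward_normal South)) =
        integral {a..b} (\<lambda>x. - (poly (r South) x * snd (q (x, c))))"
      using vb[of _ South] E int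
      by (intro segment_integral_horizontal assms) (auto simp: inner_prod_def intro: integrable_neg)
    moreover have "segment_integral (a, d) (b, d) (\<lambda>z. vb (edge K North) z * (q z \<bullet> outward_normal North)) =
        integral {a..b} (\<lambda>x. poly (r North) x * snd (q (x, d)))"
      using vb[of _ North] E int
      by (intro segment_integral_horizontal assms) (auto simp: inner_prod_def)
    ultimately show ?thesis
      by (simp add: boundary_flux_def V del: side_start.simps side_end.simps outward_normal.simps)
  qed
  ultimately show ?thesis
    using int by (simp add: load_def K integral_diff)
qed

definition field_product :: "point set \<Rightarrow> vfield \<Rightarrow> vfield \<Rightarrow> real" where
  "field_product K g q = integral K (\<lambda>z. g z \<bullet> q z)"

lemma field_product_integrable:
  fixes g q :: vfield
  assumes "polynomial_function g" "polynomial_function q"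
  shows "(\<lambda>z. g z \<bullet> q z) integrable_on cbox (a :: point) b"
  using assms unfolding polynomial_field_iff
  by (auto simp: inner_prod_def intro!: real_polynomial_function_integrable)

lemma linear_form_field_product:
  assumes "polynomial_function g"
  shows "linear_form {q. polynomial_function q} (field_product (cbox a b) g)"
  using field_product_integrable[OF assms]
  by (auto simp: linear_form_def field_product_def inner_add_right integral_add)

lemma linear_form_load:
  assumes p: "real_polynomial_function p"
  shows "linear_form {q. polynomial_function q} (load a b c d p r)"
  unfolding linear_form_def
proof (intro conjI ballI allI; unfold mem_Collect_eq)
  have D: "(\<lambda>z. p z * divergence q z) integrable_on cbox (a, c) (b, d)" if "polynomial_function q" for q
    using p divergence_polynomial[OF that] by (auto intro!: real_polynomial_function_integrable)
  {
    fix f g :: vfield assume f: "polynomial_function f" and g: "polynomial_function g"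
    note int = polynomial_field_slices_integrable[OF f] polynomial_field_slices_integrable[OF g] D[OF f] D[OF g]
    show "load a b c d p r (\<lambda>z. f z + g z) = load a b c d p r f + load a b c d p r g"
      unfolding load_def
      by (simp add: divergence_add[OF f g] distrib_left int integral_add integral_diff integrable_add)
  next
    fix t and f :: vfield assume f: "polynomial_function f"
    note int = polynomial_field_slices_integrable[OF f] D[OF f]
    show "load a b c d p r (\<lambda>z. t *\<^sub>R f z) = t * load a b c d p r f"
      unfolding load_def
      by (simp add: divergence_scale[OF f] mult.left_commute[of _ t] flip: right_diff_distrib)
        (simp add: algebra_simps)
  }
qed

text \<open>A continuous nonnegative integrand with vanishing integral vanishes on the rectangle, and a
  polynomial field that vanishes there vanishes on the whole plane.  The discrete gradient is
  therefore unique as a function on the plane, not just on the rectangle.\<close>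

lemma field_product_definite:
  assumes "a < b" "c < d" and g: "polynomial_function g"
    and 0: "field_product (cbox (a, c) (b, d)) g g = 0"
  shows "g = (\<lambda>z. 0)"
proof -
  have g12: "real_polynomial_function (\<lambda>z. fst (g z))" "real_polynomial_function (\<lambda>z. snd (g z))"
    using g by (auto simp: polynomial_field_iff)
  have ne: "box (a, c) (b, d) \<noteq> {}"
    using assms(1,2) by (auto simp: box_ne_empty Basis_prod_def inner_prod_def)
  then obtain z0 where z0: "z0 \<in> box (a, c) (b, d)" by blast
  have "continuous_on (cbox (a, c) (b, d)) (\<lambda>z. g z \<bullet> g z)"
    using g12 by (auto simp: inner_prod_def intro!: real_polynomial_function_continuous_on)
  from integral_cbox_eq_0_iff[OF this ne] 0
  have "g z = 0" if "z \<in> cbox (a, c) (b, d)" for z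
    using that by (simp add: field_product_def)
  then have "g z = 0" if "z \<in> box (a, c) (b, d)" for z
    using that box_subset_cbox by blast
  then have "fst (g z) = 0" "snd (g z) = 0" for z
    using real_polynomial_function_zero_on_open[OF g12(1) open_box z0]
      real_polynomial_function_zero_on_open[OF g12(2) open_box z0] by simp_all
  then show ?thesis
    by (auto simp: prod_eq_iff)
qed

section \<open>Spaces spanned by monomials\<close>

text \<open>Both \<open>P_space\<close> and \<open>Q_space\<close> are spanned by the monomials with exponents in a finite set of
  pairs, so degree conditions become membership in that set.\<close>

definition monomial_span :: "(nat \<times> nat) set \<Rightarrow> (point \<Rightarrow> real) set" where
  "monomial_span A = {f. \<exists>c. f = (\<lambda>(x, y). \<Sum>(i, j)\<in>A. c i j * x ^ i * y ^ j)}"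

definition monomial :: "nat \<times> nat \<Rightarrow> point \<Rightarrow> real" where
  "monomial m z = fst z ^ fst m * snd z ^ snd m"

lemma P_space_eq_monomial_span: "P_space k = monomial_span {(i, j). i + j \<le> k}"
  by (simp add: P_space_def monomial_span_def)

lemma Q_space_eq_monomial_span: "Q_space k l = monomial_span ({..k} \<times> {..l})"
  by (simp add: Q_space_def monomial_span_def sum.cartesian_product)

lemma finite_total_degree_indices: "finite {(i, j :: nat). i + j \<le> (k :: nat)}"
  by (rule finite_subset[of _ "{..k} \<times> {..k}"]) auto

lemma monomial_span_eq_function_span: "monomial_span A = function_span A monomial"
proof -
  have "(\<lambda>(x, y). \<Sum>(i, j)\<in>A. c i j * x ^ i * y ^ j) = (\<lambda>z. \<Sum>m\<in>A. case_prod c m *\<^sub>R monomial m z)" for c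
    by (auto simp: fun_eq_iff monomial_def case_prod_beta' mult.assoc)
  then have eq: "monomial_span A = {f. \<exists>c. f = (\<lambda>z. \<Sum>m\<in>A. case_prod c m *\<^sub>R monomial m z)}"
    by (simp add: monomial_span_def)
  have ex: "(\<exists>c. P (case_prod c)) \<longleftrightarrow> (\<exists>c. P c)" for P :: "(nat \<times> nat \<Rightarrow> real) \<Rightarrow> bool"
    by (metis case_prod_curry)
  show ?thesis
    unfolding eq function_span_def by (intro Collect_cong ex)
qed

lemma monomial_span_zero: "(\<lambda>z. 0) \<in> monomial_span A"
  unfolding monomial_span_eq_function_span by (rule function_subspaceD function_subspace_function_span)+

lemma monomial_span_add:
  "f \<in> monomial_span A \<Longrightarrow> g \<in> monomial_span A \<Longrightarrow> (\<lambda>z. f z + g z) \<in> monomial_span A"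
  unfolding monomial_span_eq_function_span by (rule function_subspaceD function_subspace_function_span)+

lemma monomial_span_cmult:
  "f \<in> monomial_span A \<Longrightarrow> (\<lambda>z. t * f z) \<in> monomial_span A"
  unfolding monomial_span_eq_function_span
  using function_subspaceD(3)[OF function_subspace_function_span, of f A monomial t] by simp

lemma monomial_span_sum:
  assumes "finite I" "\<And>i. i \<in> I \<Longrightarrow> f i \<in> monomial_span A"
  shows "(\<lambda>z. \<Sum>i\<in>I. f i z) \<in> monomial_span A"
  using assms by (induction I rule: finite_induct) (auto intro: monomial_span_zero monomial_span_add)

lemma monomial_in_span:
  assumes "finite A" "(i, j) \<in> A"
  shows "(\<lambda>z. t * (fst z ^ i * snd z ^ j)) \<in> monomial_span A"
proof -
  have "(\<lambda>z. t * (fst z ^ i * snd z ^ j)) = (\<lambda>z. \<Sum>m\<in>A. (if m = (i, j) then t else 0) *\<^sub>R monomial m z)"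
  proof
    fix z
    have "(\<Sum>m\<in>A. (if m = (i, j) then t else 0) *\<^sub>R monomial m z) = (\<Sum>m\<in>A. if m = (i, j) then t * monomial m z else 0)"
      by (intro sum.cong) auto
    then show "t * (fst z ^ i * snd z ^ j) = (\<Sum>m\<in>A. (if m = (i, j) then t else 0) *\<^sub>R monomial m z)"
      using assms by (simp add: monomial_def)
  qed
  then show ?thesis
    unfolding monomial_span_eq_function_span function_span_def by (intro CollectI exI)
qed

lemma real_polynomial_function_monomial: "real_polynomial_function (monomial m)"
  unfolding monomial_def[abs_def] using real_polynomial_function_fst_snd
  by (auto intro: real_polynomial_function.intros)

lemma monomial_span_polynomial:
  assumes "finite A" "f \<in> monomial_span A"
  shows "real_polynomial_function f"
proof -
  obtain c where f: "f = (\<lambda>z. \<Sum>m\<in>A. c m *\<^sub>R monomial m z)"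
    using assms(2) unfolding monomial_span_eq_function_span function_span_def by blast
  show ?thesis
    unfolding f real_scaleR_def
    by (intro real_polynomial_function_sum real_polynomial_function.intros(2,4) assms(1)
        real_polynomial_function_monomial)
qed

lemma partial_x_monomial_sum:
  "partial_x (\<lambda>(x, y). \<Sum>(i, j)\<in>A. c i j * x ^ i * y ^ j) z =
    (\<Sum>(i, j)\<in>A. c i j * (of_nat i * fst z ^ (i - 1)) * snd z ^ j)"
proof -
  have "((\<lambda>x. \<Sum>(i, j)\<in>A. c i j * x ^ i * y ^ j) has_real_derivative
      (\<Sum>(i, j)\<in>A. c i j * (of_nat i * x ^ (i - 1)) * y ^ j)) (at x)" for x y
    unfolding case_prod_beta' by (auto intro!: derivative_eq_intros sum.cong)
  then show ?thesis
    by (cases z) (auto intro!: partial_x_eqI)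
qed

lemma partial_y_monomial_sum:
  "partial_y (\<lambda>(x, y). \<Sum>(i, j)\<in>A. c i j * x ^ i * y ^ j) z =
    (\<Sum>(i, j)\<in>A. c i j * fst z ^ i * (of_nat j * snd z ^ (j - 1)))"
proof -
  have "((\<lambda>y. \<Sum>(i, j)\<in>A. c i j * x ^ i * y ^ j) has_real_derivative
      (\<Sum>(i, j)\<in>A. c i j * x ^ i * (of_nat j * y ^ (j - 1)))) (at y)" for x y
    unfolding case_prod_beta' by (auto intro!: derivative_eq_intros sum.cong)
  then show ?thesis
    by (cases z) (auto intro!: partial_y_eqI)
qed

text \<open>Differentiating lowers the exponent of \<open>x\<close> by one and the quadratic factor raises it by at
  most two, so each exponent pair of \<open>f\<close> with a positive exponent of \<open>x\<close> gives rise to three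
  neighbouring pairs.\<close>

lemma bubble_partial_x:
  assumes "finite A" "finite B" and f: "f \<in> monomial_span A"
    and AB: "\<And>i j. (Suc i, j) \<in> A \<Longrightarrow> (i, j) \<in> B \<and> (Suc i, j) \<in> B \<and> (Suc (Suc i), j) \<in> B"
  shows "(\<lambda>z. (fst z - l) * (u - fst z) * partial_x f z) \<in> monomial_span B"
proof -
  obtain c where c: "f = (\<lambda>(x, y). \<Sum>(i, j)\<in>A. c i j * x ^ i * y ^ j)"
    using f by (auto simp: monomial_span_def)
  have *: "(\<lambda>z. (fst z - l) * (u - fst z) * (c i j * (of_nat i * fst z ^ (i - 1)) * snd z ^ j)) \<in> monomial_span B"
    if "(i, j) \<in> A" for i j
  proof (cases i)
    case 0
    then show ?thesis by (simp add: monomial_span_zero)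
  next
    case (Suc k)
    let ?t = "c i j * real i"
    have "(\<lambda>z. (fst z - l) * (u - fst z) * (c i j * (of_nat i * fst z ^ (i - 1)) * snd z ^ j)) =
      (\<lambda>z. - ?t * (fst z ^ Suc (Suc k) * snd z ^ j) +
        (?t * (l + u) * (fst z ^ Suc k * snd z ^ j) + - ?t * (l * u) * (fst z ^ k * snd z ^ j)))"
      by (auto simp: fun_eq_iff Suc algebra_simps)
    also have "\<dots> \<in> monomial_span B"
      using AB that unfolding Suc by (intro monomial_span_add monomial_in_span \<open>finite B\<close>) auto
    finally show ?thesis .
  qed
  have "(\<lambda>z. (fst z - l) * (u - fst z) * partial_x f z) =
      (\<lambda>z. \<Sum>m\<in>A. (fst z - l) * (u - fst z) *
        (c (fst m) (snd m) * (of_nat (fst m) * fst z ^ (fst m - 1)) * snd z ^ snd m))"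
    unfolding c partial_x_monomial_sum by (simp add: sum_distrib_left case_prod_beta')
  also have "\<dots> \<in> monomial_span B"
    using * by (intro monomial_span_sum \<open>finite A\<close>) auto
  finally show ?thesis .
qed

lemma bubble_partial_y:
  assumes "finite A" "finite B" and f: "f \<in> monomial_span A"
    and AB: "\<And>i j. (i, Suc j) \<in> A \<Longrightarrow> (i, j) \<in> B \<and> (i, Suc j) \<in> B \<and> (i, Suc (Suc j)) \<in> B"
  shows "(\<lambda>z. (snd z - l) * (u - snd z) * partial_y f z) \<in> monomial_span B"
proof -
  obtain c where c: "f = (\<lambda>(x, y). \<Sum>(i, j)\<in>A. c i j * x ^ i * y ^ j)"
    using f by (auto simp: monomial_span_def)
  have *: "(\<lambda>z. (snd z - l) * (u - snd z) * (c i j * fst z ^ i * (of_nat j * snd z ^ (j - 1)))) \<in> monomial_span B"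
    if "(i, j) \<in> A" for i j
  proof (cases j)
    case 0
    then show ?thesis by (simp add: monomial_span_zero)
  next
    case (Suc k)
    let ?t = "c i j * real j"
    have "(\<lambda>z. (snd z - l) * (u - snd z) * (c i j * fst z ^ i * (of_nat j * snd z ^ (j - 1)))) =
      (\<lambda>z. - ?t * (fst z ^ i * snd z ^ Suc (Suc k)) +
        (?t * (l + u) * (fst z ^ i * snd z ^ Suc k) + - ?t * (l * u) * (fst z ^ i * snd z ^ k)))"
      by (auto simp: fun_eq_iff Suc algebra_simps)
    also have "\<dots> \<in> monomial_span B"
      using AB that unfolding Suc by (intro monomial_span_add monomial_in_span \<open>finite B\<close>) auto
    finally show ?thesis .
  qed
  have "(\<lambda>z. (snd z - l) * (u - snd z) * partial_y f z) =
      (\<lambda>z. \<Sum>m\<in>A. (snd z - l) * (u - snd z) *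
        (c (fst m) (snd m) * fst z ^ fst m * (of_nat (snd m) * snd z ^ (snd m - 1))))"
    unfolding c partial_y_monomial_sum by (simp add: sum_distrib_left case_prod_beta')
  also have "\<dots> \<in> monomial_span B"
    using * by (intro monomial_span_sum \<open>finite A\<close>) auto
  finally show ?thesis .
qed

lemma poly_eq_sum_atMost:
  fixes p :: "'a::comm_semiring_1 poly"
  assumes "degree p \<le> n"
  shows "poly p x = (\<Sum>i\<le>n. coeff p i * x ^ i)"
  unfolding poly_altdef using assms by (intro sum.mono_neutral_left) (auto simp: coeff_eq_0)

lemma poly_in_monomial_span:
  assumes "finite A" "degree r \<le> n"
  shows "(\<And>j. j \<le> n \<Longrightarrow> (i, j) \<in> A) \<Longrightarrow> (\<lambda>z. fst z ^ i * poly r (snd z)) \<in> monomial_span A"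
    and "(\<And>j. j \<le> n \<Longrightarrow> (j, i) \<in> A) \<Longrightarrow> (\<lambda>z. poly r (fst z) * snd z ^ i) \<in> monomial_span A"
proof -
  assume *: "\<And>j. j \<le> n \<Longrightarrow> (i, j) \<in> A"
  have "(\<lambda>z. fst z ^ i * poly r (snd z)) = (\<lambda>z. \<Sum>j\<le>n. coeff r j * (fst z ^ i * snd z ^ j))"
    by (auto simp: fun_eq_iff poly_eq_sum_atMost[OF assms(2)] sum_distrib_left mult_ac intro!: sum.cong)
  also have "\<dots> \<in> monomial_span A"
    using * by (intro monomial_span_sum monomial_in_span \<open>finite A\<close>) auto
  finally show "(\<lambda>z. fst z ^ i * poly r (snd z)) \<in> monomial_span A" .
next
  assume *: "\<And>j. j \<le> n \<Longrightarrow> (j, i) \<in> A"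
  have "(\<lambda>z. poly r (fst z) * snd z ^ i) = (\<lambda>z. \<Sum>j\<le>n. coeff r j * (fst z ^ j * snd z ^ i))"
    by (simp add: fun_eq_iff poly_eq_sum_atMost[OF assms(2)] sum_distrib_right mult.assoc)
  also have "\<dots> \<in> monomial_span A"
    using * by (intro monomial_span_sum monomial_in_span \<open>finite A\<close>) auto
  finally show "(\<lambda>z. poly r (fst z) * snd z ^ i) \<in> monomial_span A" .
qed

section \<open>The spaces RT and BDM\<close>

fun component_basis :: "(nat \<times> nat) + (nat \<times> nat) \<Rightarrow> vfield" where
  "component_basis (Inl m) z = (monomial m z, 0)"
| "component_basis (Inr m) z = (0, monomial m z)"

lemma component_basis_polynomial: "polynomial_function (component_basis m)"
  using real_polynomial_function_monomial by (cases m) (auto simp: polynomial_field_iff)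

lemma span_component_basis:
  assumes "finite A" "finite B"
  shows "function_span (A <+> B) component_basis =
    {q. (\<lambda>z. fst (q z)) \<in> monomial_span A \<and> (\<lambda>z. snd (q z)) \<in> monomial_span B}"
proof -
  have split: "(\<Sum>m\<in>A <+> B. c m *\<^sub>R component_basis m z) =
      (\<Sum>m\<in>A. c (Inl m) *\<^sub>R monomial m z, \<Sum>m\<in>B. c (Inr m) *\<^sub>R monomial m z)" for c z
  proof -
    have "(\<Sum>m\<in>A <+> B. c m *\<^sub>R component_basis m z) =
        (\<Sum>m\<in>A. (c (Inl m) *\<^sub>R monomial m z, 0)) + (\<Sum>m\<in>B. (0, c (Inr m) *\<^sub>R monomial m z))"
      using assms by (simp add: sum.Plus)
    also have "\<dots> = (\<Sum>m\<in>A. c (Inl m) *\<^sub>R monomial m z, \<Sum>m\<in>B. c (Inr m) *\<^sub>R monomial m z)"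
      by (simp add: prod_eq_iff fst_sum snd_sum)
    finally show ?thesis .
  qed
  show ?thesis
  proof (intro equalityI subsetI CollectI conjI)
    fix q assume "q \<in> function_span (A <+> B) component_basis"
    then obtain c where q: "q = (\<lambda>z. (\<Sum>m\<in>A. c (Inl m) *\<^sub>R monomial m z, \<Sum>m\<in>B. c (Inr m) *\<^sub>R monomial m z))"
      unfolding function_span_def split by blast
    show "(\<lambda>z. fst (q z)) \<in> monomial_span A" "(\<lambda>z. snd (q z)) \<in> monomial_span B"
      unfolding monomial_span_eq_function_span function_span_def q fst_conv snd_conv
      by (rule CollectI, rule exI, rule refl)+
  next
    fix q assume "q \<in> {q. (\<lambda>z. fst (q z)) \<in> monomial_span A \<and> (\<lambda>z. snd (q z)) \<in> monomial_span B}"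
    then obtain c e where "(\<lambda>z. fst (q z)) = (\<lambda>z. \<Sum>m\<in>A. c m *\<^sub>R monomial m z)"
      "(\<lambda>z. snd (q z)) = (\<lambda>z. \<Sum>m\<in>B. e m *\<^sub>R monomial m z)"
      unfolding monomial_span_eq_function_span function_span_def by blast
    then have "q = (\<lambda>z. \<Sum>m\<in>A <+> B. case_sum c e m *\<^sub>R component_basis m z)"
      unfolding split by (simp add: fun_eq_iff prod_eq_iff)
    then show "q \<in> function_span (A <+> B) component_basis"
      unfolding function_span_def by (intro CollectI exI)
  qed
qed

lemma curl_basis:
  "curl (\<lambda>(x, y). x ^ (m + 1) * y) z = (- (fst z ^ (m + 1)), real (m + 1) * fst z ^ m * snd z)"
  "curl (\<lambda>(x, y). x * y ^ (m + 1)) z = (- (real (m + 1) * fst z * snd z ^ m), snd z ^ (m + 1))"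
proof -
  obtain x y where z: "z = (x, y)" by (cases z)
  have "((\<lambda>x. x ^ (m + 1) * y) has_real_derivative real (m + 1) * x ^ m * y) (at x)"
    "((\<lambda>y. x ^ (m + 1) * y) has_real_derivative x ^ (m + 1)) (at y)"
    "((\<lambda>x. x * y ^ (m + 1)) has_real_derivative y ^ (m + 1)) (at x)"
    "((\<lambda>y. x * y ^ (m + 1)) has_real_derivative real (m + 1) * x * y ^ m) (at y)"
    by (auto intro!: derivative_eq_intros simp del: power_Suc)
  then show "curl (\<lambda>(x, y). x ^ (m + 1) * y) z = (- (fst z ^ (m + 1)), real (m + 1) * fst z ^ m * snd z)"
    "curl (\<lambda>(x, y). x * y ^ (m + 1)) z = (- (real (m + 1) * fst z * snd z ^ m), snd z ^ (m + 1))"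
    by (auto simp: curl_def partial_x_def partial_y_def z dest!: DERIV_imp_deriv)
qed

fun BDM_basis :: "nat \<Rightarrow> ((nat \<times> nat) + (nat \<times> nat)) + bool \<Rightarrow> vfield" where
  "BDM_basis m (Inl i) = component_basis i"
| "BDM_basis m (Inr True) = curl (\<lambda>(x, y). x ^ (m + 1) * y)"
| "BDM_basis m (Inr False) = curl (\<lambda>(x, y). x * y ^ (m + 1))"

definition BDM_index :: "nat \<Rightarrow> (((nat \<times> nat) + (nat \<times> nat)) + bool) set" where
  "BDM_index m = ({(i, j). i + j \<le> m} <+> {(i, j). i + j \<le> m}) <+> UNIV"

lemma BDM_basis_polynomial: "polynomial_function (BDM_basis m i)"
proof -
  have "polynomial_function (curl (\<lambda>(x, y). x ^ (m + 1) * y))"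
    "polynomial_function (curl (\<lambda>(x, y). x * y ^ (m + 1)))"
    unfolding polynomial_field_iff curl_basis fst_conv snd_conv
    by (intro conjI real_polynomial_function_minus real_polynomial_function_power
        real_polynomial_function.intros(2,4) real_polynomial_function_fst_snd)+
  then show ?thesis
    using component_basis_polynomial by (cases "(m, i)" rule: BDM_basis.cases) auto
qed

lemma BDM_eq_span: "BDM m = function_span (BDM_index m) (BDM_basis m)"
proof -
  let ?C = "{(i, j). i + j \<le> m} <+> {(i, j). i + j \<le> m}"
  let ?f = "curl (\<lambda>(x, y). x ^ (m + 1) * y)" and ?g = "curl (\<lambda>(x, y). x * y ^ (m + 1))"
  note fin = finite_total_degree_indices[of m]
  have sum: "(\<Sum>i\<in>BDM_index m. c i *\<^sub>R BDM_basis m i z) =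
      (\<Sum>i\<in>?C. c (Inl i) *\<^sub>R component_basis i z) + c (Inr True) *\<^sub>R ?f z + c (Inr False) *\<^sub>R ?g z" for c z
    using fin by (simp add: BDM_index_def sum.Plus UNIV_bool add_ac)
  show ?thesis
  proof (intro equalityI subsetI)
    fix q assume "q \<in> BDM m"
    then obtain p1 p2 s t where p: "p1 \<in> P_space m" "p2 \<in> P_space m"
      and q: "q = (\<lambda>z. (p1 z, p2 z) + s *\<^sub>R ?f z + t *\<^sub>R ?g z)"
      unfolding BDM_def by blast
    have "(\<lambda>z. (p1 z, p2 z)) \<in> function_span ?C component_basis"
      unfolding span_component_basis[OF fin fin] using p by (simp add: P_space_eq_monomial_span)
    then obtain c where "(\<lambda>z. (p1 z, p2 z)) = (\<lambda>z. \<Sum>i\<in>?C. c i *\<^sub>R component_basis i z)"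
      unfolding function_span_def by blast
    then have "q = (\<lambda>z. \<Sum>i\<in>BDM_index m. case_sum c (\<lambda>b. if b then s else t) i *\<^sub>R BDM_basis m i z)"
      unfolding sum q by (simp add: fun_eq_iff)
    then show "q \<in> function_span (BDM_index m) (BDM_basis m)"
      unfolding function_span_def by (intro CollectI exI)
  next
    fix q assume "q \<in> function_span (BDM_index m) (BDM_basis m)"
    then obtain c where q: "q = (\<lambda>z. (\<Sum>i\<in>?C. c (Inl i) *\<^sub>R component_basis i z) +
        c (Inr True) *\<^sub>R ?f z + c (Inr False) *\<^sub>R ?g z)"
      unfolding function_span_def sum by blast
    define h where "h = (\<lambda>z. \<Sum>i\<in>?C. c (Inl i) *\<^sub>R component_basis i z)"
    have "h \<in> function_span ?C component_basis"
      unfolding function_span_def h_def by (intro CollectI exI[of _ "\<lambda>i. c (Inl i)"] refl)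
    then have "(\<lambda>z. fst (h z)) \<in> P_space m" "(\<lambda>z. snd (h z)) \<in> P_space m"
      unfolding span_component_basis[OF fin fin] P_space_eq_monomial_span by auto
    moreover have "q = (\<lambda>z. (fst (h z), snd (h z)) + c (Inr True) *\<^sub>R ?f z + c (Inr False) *\<^sub>R ?g z)"
      by (simp add: q h_def)
    ultimately show "q \<in> BDM m"
      unfolding BDM_def by (intro CollectI bexI exI)
  qed
qed

lemma RT_eq_span: "RT j = function_span (({..j + 1} \<times> {..j}) <+> ({..j} \<times> {..j + 1})) component_basis"
  by (simp add: RT_def span_component_basis Q_space_eq_monomial_span)

text \<open>The first field has normal component a multiple of \<open>r\<close> on one vertical edge and zero on the
  other three edges, when \<open>e\<close> is the abscissa of the opposite edge.\<close>

lemma RT_edge_lifting: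
  assumes "degree r \<le> j"
  shows "(\<lambda>z. ((fst z - e) * poly r (snd z), 0)) \<in> RT j"
    and "(\<lambda>z. (0, (snd z - e) * poly r (fst z))) \<in> RT j"
proof -
  have "(\<lambda>z. fst z ^ 1 * poly r (snd z) + (- e) * (fst z ^ 0 * poly r (snd z))) \<in> Q_space (j + 1) j"
    unfolding Q_space_eq_monomial_span
    by (intro monomial_span_add monomial_span_cmult poly_in_monomial_span(1)[OF _ assms]) auto
  then show "(\<lambda>z. ((fst z - e) * poly r (snd z), 0)) \<in> RT j"
    unfolding RT_def Q_space_eq_monomial_span by (simp add: monomial_span_zero algebra_simps)
  have "(\<lambda>z. poly r (fst z) * snd z ^ 1 + (- e) * (poly r (fst z) * snd z ^ 0)) \<in> Q_space j (j + 1)"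
    unfolding Q_space_eq_monomial_span
    by (intro monomial_span_add monomial_span_cmult poly_in_monomial_span(2)[OF _ assms]) auto
  then show "(\<lambda>z. (0, (snd z - e) * poly r (fst z))) \<in> RT j"
    unfolding RT_def Q_space_eq_monomial_span by (simp add: monomial_span_zero algebra_simps)
qed

text \<open>If \<open>r\<close> has full degree \<open>m\<close>, the field \<open>((x - e) r(y), 0)\<close> is not in \<open>BDM m\<close>, because its
  leading part \<open>x y^m\<close> occurs there only within \<open>curl (x y^(m+1))\<close>, hence together with a term
  \<open>y^(m+1)\<close> in the second component.  That component would contribute to the normal trace on
  the horizontal edges; the free lower-order terms in \<open>R\<close> are used to make it vanish at the two
  heights \<open>c\<close> and \<open>d\<close>.\<close>

lemma BDM_edge_lifting:
  fixes r :: "real poly"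
  assumes "degree r \<le> m" "0 < m" "c < d"
  obtains R where "R c = 0" "R d = 0"
    "(\<lambda>z. ((fst z - e) * poly r (snd z), R (snd z))) \<in> BDM m"
    "(\<lambda>z. (R (fst z), (snd z - e) * poly r (fst z))) \<in> BDM m"
proof -
  \<comment> \<open>\<open>S\<close> is an antiderivative of \<open>r\<close> and \<open>\<mu>\<close> is the mean value of \<open>r\<close>, so \<open>R\<close> is an
    antiderivative of \<open>\<mu> - r\<close> vanishing at both end points: the field
    of the first membership is \<open>curl ((x - e) R(y)) + ((x - e) \<mu>, 0)\<close>.\<close>
  define S where "S y = (\<Sum>i\<le>m. coeff r i / real (i + 1) * y ^ (i + 1))" for y
  define \<mu> where "\<mu> = (S d - S c) / (d - c)"
  define R where "R y = S c - S y + \<mu> * (y - c)" for y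
  note fin = finite_total_degree_indices[of m]
  define t where "t = coeff r m / real (m + 1)"
  have r: "(x - e) * poly r y =
      (\<Sum>i<m. coeff r i * (x * y ^ i)) - e * poly r y + t * (real (m + 1) * x * y ^ m)" for x y
  proof -
    have "poly r y = (\<Sum>i<m. coeff r i * y ^ i) + coeff r m * y ^ m"
      unfolding poly_eq_sum_atMost[OF assms(1)] lessThan_Suc_atMost[symmetric] by simp
    moreover have "coeff r m = t * real (m + 1)" by (simp add: t_def)
    ultimately have "x * poly r y = (\<Sum>i<m. coeff r i * (x * y ^ i)) + t * (real (m + 1) * x * y ^ m)"
      by (simp add: distrib_left sum_distrib_left mult_ac)
    then show ?thesis
      by (simp add: left_diff_distrib)
  qed
  have R: "R y = (S c - \<mu> * c) + \<mu> * y + (\<Sum>i<m. - coeff r i / real (i + 1) * y ^ (i + 1)) - t * y ^ (m + 1)" for y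
  proof -
    have "S y = (\<Sum>i<m. coeff r i / real (i + 1) * y ^ (i + 1)) + t * y ^ (m + 1)"
      unfolding S_def t_def lessThan_Suc_atMost[symmetric] by simp
    then show ?thesis
      by (simp add: R_def sum_negf right_diff_distrib)
  qed
  show thesis
  proof
    show "R c = 0" by (simp add: R_def)
    show "R d = 0" using \<open>c < d\<close> by (simp add: R_def \<mu>_def)
    define p1 where "p1 z = (\<Sum>i<m. coeff r i * (fst z ^ 1 * snd z ^ i)) + (- e) * (fst z ^ 0 * poly r (snd z))" for z :: point
    define p2 where "p2 z = (S c - \<mu> * c) * (fst z ^ 0 * snd z ^ 0) + \<mu> * (fst z ^ 0 * snd z ^ 1) +
      (\<Sum>i<m. - coeff r i / real (i + 1) * (fst z ^ 0 * snd z ^ (i + 1)))" for z :: point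
    have "p1 \<in> P_space m" "p2 \<in> P_space m"
      unfolding P_space_eq_monomial_span p1_def[abs_def] p2_def[abs_def] using \<open>0 < m\<close>
      by (intro monomial_span_add monomial_span_sum monomial_in_span[OF fin]
          monomial_span_cmult[OF poly_in_monomial_span(1)[OF fin assms(1)]]; simp)+
    moreover have "(\<lambda>z. ((fst z - e) * poly r (snd z), R (snd z))) =
        (\<lambda>z. (p1 z, p2 z) + 0 *\<^sub>R curl (\<lambda>(x, y). x ^ (m + 1) * y) z
          + (- t) *\<^sub>R curl (\<lambda>(x, y). x * y ^ (m + 1)) z)"
      unfolding curl_basis
      by (simp add: fun_eq_iff p1_def p2_def R r)
    ultimately show "(\<lambda>z. ((fst z - e) * poly r (snd z), R (snd z))) \<in> BDM m"
      unfolding BDM_def by (intro CollectI bexI exI)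
    define p3 where "p3 z = (S c - \<mu> * c) * (fst z ^ 0 * snd z ^ 0) + \<mu> * (fst z ^ 1 * snd z ^ 0) +
      (\<Sum>i<m. - coeff r i / real (i + 1) * (fst z ^ (i + 1) * snd z ^ 0))" for z :: point
    define p4 where "p4 z = (\<Sum>i<m. coeff r i * (fst z ^ i * snd z ^ 1)) + (- e) * (poly r (fst z) * snd z ^ 0)" for z :: point
    have "p3 \<in> P_space m" "p4 \<in> P_space m"
      unfolding P_space_eq_monomial_span p3_def[abs_def] p4_def[abs_def] using \<open>0 < m\<close>
      by (intro monomial_span_add monomial_span_sum monomial_in_span[OF fin]
          monomial_span_cmult[OF poly_in_monomial_span(2)[OF fin assms(1)]]; simp)+
    moreover have "(\<lambda>z. (R (fst z), (snd z - e) * poly r (fst z))) =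
        (\<lambda>z. (p3 z, p4 z) + t *\<^sub>R curl (\<lambda>(x, y). x ^ (m + 1) * y) z
          + 0 *\<^sub>R curl (\<lambda>(x, y). x * y ^ (m + 1)) z)"
      unfolding curl_basis
      by (simp add: fun_eq_iff p3_def p4_def R r mult_ac)
    ultimately show "(\<lambda>z. (R (fst z), (snd z - e) * poly r (fst z))) \<in> BDM m"
      unfolding BDM_def by (intro CollectI bexI exI)
  qed
qed

section \<open>Kernel of the discrete gradient on one rectangle\<close>

text \<open>Green's formula moves the derivative from \<open>q\<close> to \<open>p\<close>.  What remains on the edges is the
  jump between the edge value and the trace of the interior value; the load thus vanishes when
  both are the same constant, and the converse is what the test fields below show.\<close>

lemma load_eq_gradient_and_jumps:
  assumes p: "real_polynomial_function p" and q: "polynomial_function q" and "l1 \<le> u1" "l2 \<le> u2"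
  shows "load l1 u1 l2 u2 p r q =
    integral (cbox (l1, l2) (u1, u2)) (\<lambda>z. partial_x p z * fst (q z) + partial_y p z * snd (q z)) +
    integral {l2..u2} (\<lambda>y. (poly (r East) y - p (u1, y)) * fst (q (u1, y)) -
      (poly (r West) y - p (l1, y)) * fst (q (l1, y))) +
    integral {l1..u1} (\<lambda>x. (poly (r North) x - p (x, u2)) * snd (q (x, u2)) -
      (poly (r South) x - p (x, l2)) * snd (q (x, l2)))"
proof -
  note rq = polynomial_field_slices_integrable[OF q]
  have "real_polynomial_function (\<lambda>z. p z * fst (q z))" "real_polynomial_function (\<lambda>z. p z * snd (q z))"
    using p q by (auto simp: polynomial_field_iff)
  from real_polynomial_function_slice(2)[OF this(1)] real_polynomial_function_slice(1)[OF this(2)]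
  have pq: "(\<lambda>y. p (x, y) * fst (q (x, y))) integrable_on {c..d}"
    "(\<lambda>x. p (x, y) * snd (q (x, y))) integrable_on {c..d}" for x y c d
    by (metis real_polynomial_function_integrable box_real(2))+
  have "integral {l2..u2} (\<lambda>y. (poly (r East) y - p (u1, y)) * fst (q (u1, y)) -
      (poly (r West) y - p (l1, y)) * fst (q (l1, y))) =
    integral {l2..u2} (\<lambda>y. poly (r East) y * fst (q (u1, y)) - poly (r West) y * fst (q (l1, y))) -
    integral {l2..u2} (\<lambda>y. p (u1, y) * fst (q (u1, y)) - p (l1, y) * fst (q (l1, y)))"
    using rq pq by (subst integral_diff[symmetric]) (auto simp: algebra_simps intro!: integrable_diff)
  moreover have "integral {l1..u1} (\<lambda>x. (poly (r North) x - p (x, u2)) * snd (q (x, u2)) -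
      (poly (r South) x - p (x, l2)) * snd (q (x, l2))) =
    integral {l1..u1} (\<lambda>x. poly (r North) x * snd (q (x, u2)) - poly (r South) x * snd (q (x, l2))) -
    integral {l1..u1} (\<lambda>x. p (x, u2) * snd (q (x, u2)) - p (x, l2) * snd (q (x, l2)))"
    using rq pq by (subst integral_diff[symmetric]) (auto simp: algebra_simps intro!: integrable_diff)
  ultimately show ?thesis
    using green_formula[OF assms] unfolding load_def by linarith
qed

lemma weighted_square_integral_zero:
  fixes f :: "'a::euclidean_space \<Rightarrow> real"
  assumes f: "real_polynomial_function f" and w: "continuous_on (cbox a b) w"
    and pos: "\<And>z. z \<in> cbox a b \<Longrightarrow> 0 \<le> w z" "\<And>z. z \<in> box a b \<Longrightarrow> 0 < w z"
    and ne: "box a b \<noteq> {}" and 0: "integral (cbox a b) (\<lambda>z. f z * (w z * f z)) = 0"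
  shows "f z = 0"
proof -
  have "continuous_on (cbox a b) (\<lambda>z. f z * (w z * f z))"
    by (intro continuous_on_mult real_polynomial_function_continuous_on f w)
  moreover have "0 \<le> f z * (w z * f z)" if "z \<in> cbox a b" for z
    by (subst mult.left_commute) (intro mult_nonneg_nonneg pos(1)[OF that] zero_le_square)
  ultimately have "f z * (w z * f z) = 0" if "z \<in> box a b" for z
    using integral_cbox_eq_0_iff[OF _ ne, of "\<lambda>z. f z * (w z * f z)"] 0 that box_subset_cbox[of a b] by blast
  then have "f z = 0" if "z \<in> box a b" for z
    using pos(2)[OF that] that by force
  moreover obtain z0 where "z0 \<in> box a b" using ne by blast
  ultimately show ?thesis
    using real_polynomial_function_zero_on_open[OF f open_box] by blast
qed

lemma poly_weighted_square_integral_zero: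
  fixes p :: "real poly"
  assumes "c < d" "0 < w" "integral {c..d} (\<lambda>y. poly p y * (w * poly p y)) = 0"
  shows "p = 0"
proof -
  from weighted_square_integral_zero[OF real_polynomial_function_poly[of p], of c d "\<lambda>_. w"] assms
  have "poly p = poly 0"
    by (auto simp: fun_eq_iff)
  then show ?thesis
    by (simp only: poly_eq_poly_eq_iff)
qed

text \<open>The properties of a local gradient space \<open>V\<close> that determine the kernel of the discrete
  gradient.  The bubbles have no normal trace on the boundary and test a partial derivative of an
  interior function against a nonnegative multiple of itself.  The liftings prescribe the normal
  trace on one edge and have none on the others; the function \<open>R\<close> stands for the other
  component, which \<open>V\<close> may force upon the field, and it vanishes on the two edges where it is the
  normal component.\<close>

locale rectangular_element =
  fixes I :: "'i set" and b :: "'i \<Rightarrow> vfield" and V :: "vfield set"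
    and P0 :: "(point \<Rightarrow> real) set" and k :: nat
  assumes finite_I: "finite I"
    and basis_polynomial: "\<And>i. i \<in> I \<Longrightarrow> polynomial_function (b i)"
    and V_eq_span: "V = function_span I b"
    and P0_polynomial: "\<And>p. p \<in> P0 \<Longrightarrow> real_polynomial_function p"
    and bubble_x: "\<And>p l u. p \<in> P0 \<Longrightarrow> (\<lambda>z. ((fst z - l) * (u - fst z) * partial_x p z, 0)) \<in> V"
    and bubble_y: "\<And>p l u. p \<in> P0 \<Longrightarrow> (\<lambda>z. (0, (snd z - l) * (u - snd z) * partial_y p z)) \<in> V"
    and lifting_x: "\<And>r c d e. degree r \<le> k \<Longrightarrow> c < d \<Longrightarrow>
      \<exists>R. R c = 0 \<and> R d = 0 \<and> (\<lambda>z. ((fst z - e) * poly r (snd z), R (snd z))) \<in> V"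
    and lifting_y: "\<And>r c d e. degree r \<le> k \<Longrightarrow> c < d \<Longrightarrow>
      \<exists>R. R c = 0 \<and> R d = 0 \<and> (\<lambda>z. (R (fst z), (snd z - e) * poly r (fst z))) \<in> V"
begin

lemma V_polynomial: "q \<in> V \<Longrightarrow> polynomial_function q"
  using function_span_subset[OF polynomial_fields_subspace finite_I, of b] basis_polynomial
  by (auto simp: V_eq_span)

lemmas V_subspace = function_subspaceD[OF function_subspace_function_span[of I b], folded V_eq_span]

text \<open>Existence is the representation of the load by the inner product on the finite-dimensional
  space \<open>V\<close>; without it the description operator in \<open>discrete_gradient\<close> would say nothing about
  the load.\<close>

lemma discrete_gradient_exists_unique:
  assumes "l1 < u1" "l2 < u2" and p: "real_polynomial_function p"
  shows "\<exists>!g. g \<in> V \<and> (\<forall>q\<in>V. field_product (cbox (l1, l2) (u1, u2)) g q = load l1 u1 l2 u2 p r q)"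
proof (rule ex_ex1I)
  let ?B = "field_product (cbox (l1, l2) (u1, u2))" and ?L = "load l1 u1 l2 u2 p r"
  let ?W = "{q :: vfield. polynomial_function q}"
  have "\<exists>g\<in>V. \<forall>q\<in>V. ?B g q = ?L q"
    unfolding V_eq_span
    by (rule representation_on_function_span[OF polynomial_fields_subspace finite_I _ _ _ _ linear_form_load[OF p]])
      (auto simp: basis_polynomial linear_form_field_product intro: field_product_definite[OF assms(1,2)],
       simp add: field_product_def inner_commute)
  then show "\<exists>g. g \<in> V \<and> (\<forall>q\<in>V. ?B g q = ?L q)" by blast
  fix g h assume g: "g \<in> V \<and> (\<forall>q\<in>V. ?B g q = ?L q)" and h: "h \<in> V \<and> (\<forall>q\<in>V. ?B h q = ?L q)"
  define f where "f = (\<lambda>z. g z + (-1) *\<^sub>R h z)"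
  have f: "f \<in> V" unfolding f_def using g h by (intro V_subspace) auto
  have "?B f g = ?B f h"
    using g h f by (simp add: field_product_def inner_commute)
  moreover have "?B f f = ?B f g + (-1) * ?B f h"
  proof -
    note form = linear_formD[OF linear_form_field_product[OF V_polynomial[OF f]]]
    have gh: "g \<in> ?W" "h \<in> ?W" "(\<lambda>z. (-1) *\<^sub>R h z) \<in> ?W"
      using g h V_polynomial V_subspace(3)[of h "-1"] by auto
    have "?B f (\<lambda>z. g z + (-1) *\<^sub>R h z) = ?B f g + ?B f (\<lambda>z. (-1) *\<^sub>R h z)"
      by (rule form(1)[OF gh(1,3)])
    also have "\<dots> = ?B f g + (-1) * ?B f h"
      by (simp only: form(2)[OF gh(2)])
    finally show ?thesis by (simp only: f_def)
  qed
  ultimately have "?B f f = 0" by simp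
  then have "f = (\<lambda>z. 0)"
    using field_product_definite[OF assms(1,2) V_polynomial[OF f]] by simp
  then show "g = h"
    by (auto simp: f_def fun_eq_iff)
qed

text \<open>Against the bubbles the load is the integral of the square of a partial derivative of \<open>p\<close> with
  a weight that is positive in the interior, so both partial derivatives vanish.\<close>

lemma gradient_zero_if_load_zero:
  assumes "l1 < u1" "l2 < u2" and p: "p \<in> P0"
    and load: "\<And>q. q \<in> V \<Longrightarrow> load l1 u1 l2 u2 p r q = 0"
  obtains t where "p = (\<lambda>z. t)"
proof -
  let ?K = "cbox (l1, l2) (u1, u2)"
  note pp = P0_polynomial[OF p]
  note load_eq = load_eq_gradient_and_jumps[OF pp V_polynomial less_imp_le[OF assms(1)] less_imp_le[OF assms(2)]]
  have ne: "box (l1, l2) (u1, u2) \<noteq> {}"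
    using assms(1,2) by (auto simp: box_ne_empty Basis_prod_def inner_prod_def)
  have mem: "l1 \<le> fst z" "fst z \<le> u1" "l2 \<le> snd z" "snd z \<le> u2" if "z \<in> ?K" for z
    using that by (auto simp: mem_box Basis_prod_def inner_prod_def)
  have mem': "l1 < fst z" "fst z < u1" "l2 < snd z" "snd z < u2" if "z \<in> box (l1, l2) (u1, u2)" for z
    using that by (auto simp: mem_box Basis_prod_def inner_prod_def)
  have "partial_x p z = 0" for z
  proof (rule weighted_square_integral_zero[OF partial_x_polynomial(2)[OF pp] _ _ _ ne])
    show "integral ?K (\<lambda>z. partial_x p z * ((fst z - l1) * (u1 - fst z) * partial_x p z)) = 0"
      using load[OF bubble_x[OF p], of l1 u1] load_eq[OF bubble_x[OF p], of r l1 u1] by simp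
    show "continuous_on ?K (\<lambda>z. (fst z - l1) * (u1 - fst z))"
      by (intro continuous_intros)
  qed (use mem mem' in auto)
  then have "((\<lambda>x. p (x, y)) has_real_derivative 0) (at x)" for x y
    using partial_x_polynomial(1)[OF pp, of y x] by simp
  then have px: "p (x, y) = p (x', y)" for x x' y
    using DERIV_isconst_all[of "\<lambda>x. p (x, y)" x x'] by blast
  have "partial_y p z = 0" for z
  proof (rule weighted_square_integral_zero[OF partial_y_polynomial(2)[OF pp] _ _ _ ne])
    show "integral ?K (\<lambda>z. partial_y p z * ((snd z - l2) * (u2 - snd z) * partial_y p z)) = 0"
      using load[OF bubble_y[OF p], of l2 u2] load_eq[OF bubble_y[OF p], of r l2 u2] by simp
    show "continuous_on ?K (\<lambda>z. (snd z - l2) * (u2 - snd z))"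
      by (intro continuous_intros)
  qed (use mem mem' in auto)
  then have "((\<lambda>y. p (x, y)) has_real_derivative 0) (at y)" for x y
    using partial_y_polynomial(1)[OF pp, of x y] by simp
  then have py: "p (x, y) = p (x, y')" for x y y'
    using DERIV_isconst_all[of "\<lambda>y. p (x, y)" y y'] by blast
  have "p z = p (0, 0)" for z
    using px[of "fst z" "snd z" 0] py[of 0 "snd z" 0] by simp
  then show thesis
    using that by blast
qed

text \<open>Lifting the jump \<open>r s - t\<close> on one edge into \<open>V\<close> turns the load into a positive multiple of the
  integral of the square of that jump.\<close>

lemma edge_polynomials_constant_if_load_zero:
  assumes "l1 < u1" "l2 < u2" and r: "\<And>s. degree (r s) \<le> k"
    and load: "\<And>q. q \<in> V \<Longrightarrow> load l1 u1 l2 u2 (\<lambda>z. t) r q = 0"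
  shows "r s = [:t:]"
proof -
  note load_eq = load_eq_gradient_and_jumps[OF real_polynomial_function.intros(2) V_polynomial
      less_imp_le[OF assms(1)] less_imp_le[OF assms(2)], unfolded partial_const]
  define \<rho> where "\<rho> = r s - [:t:]"
  have deg: "degree \<rho> \<le> k"
    unfolding \<rho>_def using r by (intro degree_diff_le) auto
  have \<rho>: "poly (r s) y - t = poly \<rho> y" for y
    by (simp add: \<rho>_def)
  have "\<rho> = 0"
  proof (cases s)
    case East
    obtain R where R: "R l2 = 0" "R u2 = 0" and q: "(\<lambda>z. ((fst z - l1) * poly \<rho> (snd z), R (snd z))) \<in> V"
      using lifting_x[OF deg assms(2)] by blast
    show ?thesis
      using load[OF q] load_eq[OF q, of t r] R \<rho> East assms
      by (intro poly_weighted_square_integral_zero[of l2 u2 "u1 - l1"]) simp_all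
  next
    case West
    obtain R where R: "R l2 = 0" "R u2 = 0" and q: "(\<lambda>z. ((fst z - u1) * poly \<rho> (snd z), R (snd z))) \<in> V"
      using lifting_x[OF deg assms(2)] by blast
    \<comment> \<open>On this side both the outward normal and the factor \<open>l1 - u1\<close> are negative.\<close>
    have "- (x * ((l1 - u1) * x)) = x * ((u1 - l1) * x)" for x :: real
      by (simp add: algebra_simps)
    then show ?thesis
      using load[OF q] load_eq[OF q, of t r] R \<rho> West assms
      by (intro poly_weighted_square_integral_zero[of l2 u2 "u1 - l1"]) (simp_all del: integral_neg)
  next
    case North
    obtain R where R: "R l1 = 0" "R u1 = 0" and q: "(\<lambda>z. (R (fst z), (snd z - l2) * poly \<rho> (fst z))) \<in> V"
      using lifting_y[OF deg assms(1)] by blast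
    show ?thesis
      using load[OF q] load_eq[OF q, of t r] R \<rho> North assms
      by (intro poly_weighted_square_integral_zero[of l1 u1 "u2 - l2"]) simp_all
  next
    case South
    obtain R where R: "R l1 = 0" "R u1 = 0" and q: "(\<lambda>z. (R (fst z), (snd z - u2) * poly \<rho> (fst z))) \<in> V"
      using lifting_y[OF deg assms(1)] by blast
    have "- (x * ((l2 - u2) * x)) = x * ((u2 - l2) * x)" for x :: real
      by (simp add: algebra_simps)
    then show ?thesis
      using load[OF q] load_eq[OF q, of t r] R \<rho> South assms
      by (intro poly_weighted_square_integral_zero[of l1 u1 "u2 - l2"]) (simp_all del: integral_neg)
  qed
  then show ?thesis by (simp add: \<rho>_def)
qed

lemma discrete_gradient_characterization:
  assumes "l1 < u1" "l2 < u2" and K: "K = cbox (l1, l2) (u1, u2)"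
    and p: "real_polynomial_function p"
    and v0: "\<And>z. z \<in> interior K \<Longrightarrow> fst v K z = p z"
    and vb: "\<And>s z. z \<in> edge K s \<Longrightarrow> snd v (edge K s) z = poly (r s) (edge_coordinate s z)"
  shows "g = discrete_gradient V v K \<longleftrightarrow> g \<in> V \<and> (\<forall>q\<in>V. field_product K g q = load l1 u1 l2 u2 p r q)"
proof -
  have rhs: "- integral K (\<lambda>z. fst v K z * divergence q z) + boundary_flux (snd v) q K = load l1 u1 l2 u2 p r q"
    if "q \<in> V" for q
    by (rule load_eq_right_hand_side[OF assms(1,2) K v0 vb V_polynomial[OF that]])
  have "discrete_gradient V v K = (THE g. g \<in> V \<and> (\<forall>q\<in>V. field_product K g q = load l1 u1 l2 u2 p r q))"
    unfolding discrete_gradient_def field_product_def by (simp only: rhs cong: ball_cong)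
  then show ?thesis
    using theI_unique[OF discrete_gradient_exists_unique[OF assms(1,2) p, of r], folded K, of g] by simp
qed

text \<open>A discrete gradient that vanishes on the rectangle makes the load vanish on all of \<open>V\<close>, and the
  two preceding test field arguments apply.  Conversely, for a constant weak function the zero
  field satisfies the defining equation and is the discrete gradient by uniqueness.\<close>

lemma discrete_gradient_zero_iff:
  assumes "l1 < u1" "l2 < u2" and K: "K = cbox (l1, l2) (u1, u2)"
    and p: "p \<in> P0" and v0: "\<And>z. z \<in> interior K \<Longrightarrow> fst v K z = p z"
    and vb: "\<And>s. snd v (edge K s) \<in> P_edge k (edge K s)"
  shows "(\<forall>z\<in>K. discrete_gradient V v K z = 0) \<longleftrightarrow>
    (\<exists>c. (\<forall>z\<in>interior K. fst v K z = c) \<and> (\<forall>F\<in>edges K. \<forall>z\<in>F. snd v F z = c))"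
proof
  have "\<exists>r. degree r \<le> k \<and> (\<forall>z\<in>edge K s. snd v (edge K s) z = poly r (edge_coordinate s z))" for s
    using P_edge_as_poly_of_coordinate[OF assms(1,2) vb[of s, unfolded K]] unfolding K by metis
  then obtain r where r: "\<And>s. degree (r s) \<le> k"
    "\<And>s z. z \<in> edge K s \<Longrightarrow> snd v (edge K s) z = poly (r s) (edge_coordinate s z)"
    by metis
  assume 0: "\<forall>z\<in>K. discrete_gradient V v K z = 0"
  define g where "g = discrete_gradient V v K"
  have "field_product K g q = 0" for q
    unfolding field_product_def using 0
    by (subst integral_cong[of K _ "\<lambda>z. 0"]) (auto simp: g_def)
  then have load: "load l1 u1 l2 u2 p r q = 0" if "q \<in> V" for q
    using discrete_gradient_characterization[OF assms(1,2) K P0_polynomial[OF p] v0 r(2), of g] that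
    unfolding g_def by auto
  obtain t where t: "p = (\<lambda>z. t)"
    using gradient_zero_if_load_zero[OF assms(1,2) p load] by blast
  have "r s = [:t:]" for s
    using edge_polynomials_constant_if_load_zero[OF assms(1,2) r(1) load[unfolded t]] by blast
  then show "\<exists>c. (\<forall>z\<in>interior K. fst v K z = c) \<and> (\<forall>F\<in>edges K. \<forall>z\<in>F. snd v F z = c)"
    using v0 r(2) t by (intro exI[of _ t]) (auto simp: edges_def)
next
  assume "\<exists>c. (\<forall>z\<in>interior K. fst v K z = c) \<and> (\<forall>F\<in>edges K. \<forall>z\<in>F. snd v F z = c)"
  then obtain c where c: "\<And>z. z \<in> interior K \<Longrightarrow> fst v K z = c"
    "\<And>s z. z \<in> edge K s \<Longrightarrow> snd v (edge K s) z = poly [:c:] (edge_coordinate s z)"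
    unfolding edges_def by (auto, metis (full_types) side.exhaust)
  have "load l1 u1 l2 u2 (\<lambda>z. c) (\<lambda>s. [:c:]) q = 0" if "q \<in> V" for q
    using load_eq_gradient_and_jumps[OF real_polynomial_function.intros(2) V_polynomial[OF that]
        less_imp_le[OF assms(1)] less_imp_le[OF assms(2)], of c]
    by (simp add: partial_const)
  moreover have "field_product K (\<lambda>z. 0) q = 0" for q
    by (simp add: field_product_def)
  ultimately have "(\<lambda>z. 0) = discrete_gradient V v K"
    using V_subspace(1)
      discrete_gradient_characterization[OF assms(1,2) K real_polynomial_function.intros(2) c, of "\<lambda>z. 0"]
    by auto
  then show "\<forall>z\<in>K. discrete_gradient V v K z = 0"
    by (metis (mono_tags, lifting))
qed

end

section \<open>The two families of elements\<close>

lemma rectangular_element_RT: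
  "rectangular_element (({..j + 1} \<times> {..j}) <+> ({..j} \<times> {..j + 1})) component_basis (RT j) (Q_space j j) j"
proof
  fix p :: "point \<Rightarrow> real" and l u assume p: "p \<in> Q_space j j"
  show "(\<lambda>z. ((fst z - l) * (u - fst z) * partial_x p z, 0)) \<in> RT j"
    using p bubble_partial_x[of "{..j} \<times> {..j}" "{..j + 1} \<times> {..j}" p l u]
    by (simp add: RT_def Q_space_eq_monomial_span monomial_span_zero)
  show "(\<lambda>z. (0, (snd z - l) * (u - snd z) * partial_y p z)) \<in> RT j"
    using p bubble_partial_y[of "{..j} \<times> {..j}" "{..j} \<times> {..j + 1}" p l u]
    by (simp add: RT_def Q_space_eq_monomial_span monomial_span_zero)
next
  fix r :: "real poly" and c d e :: real
  assume "degree r \<le> j"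
  then show "\<exists>R. R c = 0 \<and> R d = 0 \<and> (\<lambda>z. ((fst z - e) * poly r (snd z), R (snd z))) \<in> RT j"
    "\<exists>R. R c = 0 \<and> R d = 0 \<and> (\<lambda>z. (R (fst z), (snd z - e) * poly r (fst z))) \<in> RT j"
    using RT_edge_lifting by (auto intro!: exI[of _ "\<lambda>y. 0"])
qed (auto simp: RT_eq_span component_basis_polynomial Q_space_eq_monomial_span
    intro: monomial_span_polynomial[of "{..j} \<times> {..j}"])

lemma rectangular_element_BDM:
  "rectangular_element (BDM_index (j + 1)) (BDM_basis (j + 1)) (BDM (j + 1)) (P_space j) (j + 1)"
proof
  note fin = finite_total_degree_indices
  have mem: "(\<lambda>z. (p1 z, p2 z)) \<in> BDM (j + 1)" if "p1 \<in> P_space (j + 1)" "p2 \<in> P_space (j + 1)" for p1 p2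
  proof -
    have "(\<lambda>z. (p1 z, p2 z)) = (\<lambda>z. (p1 z, p2 z) + 0 *\<^sub>R curl (\<lambda>(x, y). x ^ (j + 1 + 1) * y) z
              + 0 *\<^sub>R curl (\<lambda>(x, y). x * y ^ (j + 1 + 1)) z)"
      by simp
    then show ?thesis
      unfolding BDM_def using that by (intro CollectI bexI exI)
  qed
  fix p :: "point \<Rightarrow> real" and l u assume p: "p \<in> P_space j"
  show "(\<lambda>z. ((fst z - l) * (u - fst z) * partial_x p z, 0)) \<in> BDM (j + 1)"
    using p bubble_partial_x[OF fin fin, of p j "j + 1" l u]
    by (intro mem) (simp_all add: P_space_eq_monomial_span monomial_span_zero)
  show "(\<lambda>z. (0, (snd z - l) * (u - snd z) * partial_y p z)) \<in> BDM (j + 1)"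
    using p bubble_partial_y[OF fin fin, of p j "j + 1" l u]
    by (intro mem) (simp_all add: P_space_eq_monomial_span monomial_span_zero)
next
  fix r :: "real poly" and c d e :: real
  assume "degree r \<le> j + 1" "c < d"
  then obtain R where "R c = 0" "R d = 0"
    "(\<lambda>z. ((fst z - e) * poly r (snd z), R (snd z))) \<in> BDM (j + 1)"
    "(\<lambda>z. (R (fst z), (snd z - e) * poly r (fst z))) \<in> BDM (j + 1)"
    using BDM_edge_lifting[of r "j + 1" c d e] by auto
  then show "\<exists>R. R c = 0 \<and> R d = 0 \<and> (\<lambda>z. ((fst z - e) * poly r (snd z), R (snd z))) \<in> BDM (j + 1)"
    "\<exists>R. R c = 0 \<and> R d = 0 \<and> (\<lambda>z. (R (fst z), (snd z - e) * poly r (fst z))) \<in> BDM (j + 1)"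
    by blast+
qed (auto simp: BDM_eq_span BDM_basis_polynomial BDM_index_def P_space_eq_monomial_span
    finite_total_degree_indices intro: monomial_span_polynomial[OF finite_total_degree_indices])

theorem lemma2p1:
  fixes \<Omega> :: "point set" and \<T> :: "point set set" and \<sigma> \<tau> :: real and j :: nat
    and S :: "weak_fun set" and V :: "vfield set" and v :: weak_fun and K :: "point set"
  assumes "open \<Omega>" and "connected \<Omega>" and "\<Omega> \<noteq> {}" and "bounded \<Omega>"
    and "lipschitz_boundary \<Omega>"
    and "rectangular_mesh \<Omega> \<T>" and "shape_regular \<sigma> \<T>" and "quasi_uniform \<tau> \<T>"
    and "(S = weak_space \<T> (Q_space j j) (P_edge j) \<and> V = RT j) \<or>
         (S = weak_space \<T> (P_space j) (P_edge (j + 1)) \<and> V = BDM (j + 1))"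
    and "v \<in> S" and "K \<in> \<T>"
  shows "(\<forall>z\<in>K. discrete_gradient V v K z = 0) \<longleftrightarrow>
         (\<exists>c. (\<forall>z\<in>interior K. fst v K z = c) \<and> (\<forall>F\<in>edges K. \<forall>z\<in>F. snd v F z = c))"
proof -
  have "\<T> division_of closure \<Omega>" "interior K \<noteq> {}"
    using assms(6,11) by (auto simp: rectangular_mesh_def)
  then obtain x y :: point where xy: "K = cbox x y" and "box x y \<noteq> {}"
    using assms(11) by (metis division_ofD(4) interior_cbox)
  obtain l1 l2 u1 u2 where "x = (l1, l2)" "y = (u1, u2)"
    by (cases x, cases y)
  then have K: "K = cbox (l1, l2) (u1, u2)" and less: "l1 < u1" "l2 < u2"
    using xy \<open>box x y \<noteq> {}\<close> by (auto simp: box_ne_empty Basis_prod_def inner_prod_def)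
  have edge: "edge K s \<in> mesh_edges \<T>" for s
    using assms(11) by (cases s) (auto simp: mesh_edges_def edges_def)
  from assms(9) show ?thesis
  proof
    assume SV: "S = weak_space \<T> (Q_space j j) (P_edge j) \<and> V = RT j"
    then obtain p where p: "p \<in> Q_space j j" "\<And>z. z \<in> interior K \<Longrightarrow> fst v K z = p z"
      using assms(10,11) by (auto simp: weak_space_def)
    have vb: "snd v (edge K s) \<in> P_edge j (edge K s)" for s
      using assms(10) SV edge by (auto simp: weak_space_def)
    show ?thesis
      unfolding conjunct2[OF SV]
      by (rule rectangular_element.discrete_gradient_zero_iff[OF rectangular_element_RT less K p vb])
  next
    assume SV: "S = weak_space \<T> (P_space j) (P_edge (j + 1)) \<and> V = BDM (j + 1)"
    then obtain p where p: "p \<in> P_space j" "\<And>z. z \<in> interior K \<Longrightarrow> fst v K z = p z"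
      using assms(10,11) by (auto simp: weak_space_def)
    have vb: "snd v (edge K s) \<in> P_edge (j + 1) (edge K s)" for s
      using assms(10) SV edge by (auto simp: weak_space_def)
    show ?thesis
      unfolding conjunct2[OF SV]
      by (rule rectangular_element.discrete_gradient_zero_iff[OF rectangular_element_BDM less K p vb])
  qed
qed

end
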